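(* Let $m\ge 2$ and consider the billiard on the torus $\mathbb{T}^m=\mathbb{R}^m/\mathbb{Z}^m$ with one small obstacle $O$. Then its admissible rotation set $AR\subset\mathbb{R}^m$ is convex.
   Context: Setting: the obstacle $O$ on $\mathbb{T}^m$ lifts to a family of pairwise disjoint sets $O_{\mathbf{k}}=O_{\mathbf{0}}+\mathbf{k}$, $\mathbf{k}\in\mathbb{Z}^m$, in $\mathbb{R}^m$, where $O_{\mathbf{0}}$ is compact, has nonempty interior and smooth boundary, and is strictly convex (convex, with boundary containing no straight line segment). $O$ is small if it is contained in a closed ball of radius smaller than $\sqrt{2}/4$ (the lifting is then chosen so that $O_{\mathbf{k}}$ is contained in such a ball centered at $\mathbf{k}$). Billiard trajectories move with unit speed along straight lines outside the interiors of the obstacles and reflect from obstacle boundaries with angle of incidence equal to angle of reflection; trajectories are lifted to $\mathbb{R}^m$, and the time along a trajectory piece equals its length. A tangency is not counted as a reflection. Admissibility: $O_{\mathbf{k}}$ is between $O_{\mathbf{i}}$ and $O_{\mathbf{j}}$ if $\mathbf{k}\ne\mathbf{i},\mathbf{j}$ and $O_{\mathbf{k}}$ intersects the convex hull of $O_{\mathbf{i}}\cup O_{\mathbf{j}}$. A (finite or infinite) sequence $(\mathbf{k}_n)_{n\ge 0}$ in $\mathbb{Z}^m$ is admissible if (1) $\mathbf{k}_0=\mathbf{0}$; (2) $\mathbf{k}_{n+1}\ne\mathbf{k}_n$ for every $n$; (3) for every $n$ there is no obstacle between $O_{\mathbf{k}_n}$ and $O_{\mathbf{k}_{n+1}}$;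 (4) for every $n$ the obstacle $O_{\mathbf{k}_{n+1}}$ is not between $O_{\mathbf{k}_n}$ and $O_{\mathbf{k}_{n+2}}$. A trajectory piece in $\mathbb{R}^m$ has type $(\mathbf{k}_n)_{n=0}^s$ if it starts on the boundary of $O_{\mathbf{k}_0}$, reflects consecutively from $O_{\mathbf{k}_1},\dots,O_{\mathbf{k}_{s-1}}$ and ends on the boundary of $O_{\mathbf{k}_s}$ (translating so that $\mathbf{k}_0=\mathbf{0}$). The admissible rotation set $AR$ is the set of all limits of sequences $((\mathbf{y}_n-\mathbf{x}_n)/t_n)_{n=1}^\infty$ such that there is a trajectory piece of admissible type in $\mathbb{R}^m$ from $\mathbf{x}_n$ to $\mathbf{y}_n$ of length $t_n$, and $t_n\to\infty$. *)

theory Defs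
  imports "HOL-Analysis.Analysis"
begin

section \<open>Smooth hypersurfaces and their normals\<close>

text \<open>Meant for open \<open>U\<close>: partial derivatives are taken in all directions \<open>v\<close>.\<close>

primrec Ck_on :: "nat \<Rightarrow> 'a::euclidean_space set \<Rightarrow> ('a \<Rightarrow> real) \<Rightarrow> bool" where
  "Ck_on 0 U f \<longleftrightarrow> continuous_on U f"
| "Ck_on (Suc j) U f \<longleftrightarrow> (\<forall>x\<in>U. f differentiable (at x)) \<and>
     (\<forall>v. Ck_on j U (\<lambda>x. frechet_derivative f (at x) v))"

definition smooth_on :: "'a::euclidean_space set \<Rightarrow> ('a \<Rightarrow> real) \<Rightarrow> bool" where
  "smooth_on U f \<longleftrightarrow> (\<forall>j. Ck_on j U f)"

definition local_defining_function ::
    "'a::euclidean_space set \<Rightarrow> 'a \<Rightarrow> 'a set \<Rightarrow> ('a \<Rightarrow> real) \<Rightarrow> bool" where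
  "local_defining_function S p U f \<longleftrightarrow> open U \<and> p \<in> U \<and> smooth_on U f \<and>
     S \<inter> U = {x \<in> U. f x = 0} \<and>
     (\<forall>x\<in>U. \<exists>v. frechet_derivative f (at x) v \<noteq> 0)"

definition smooth_hypersurface :: "'a::euclidean_space set \<Rightarrow> bool" where
  "smooth_hypersurface S \<longleftrightarrow> (\<forall>p\<in>S. \<exists>U f. local_defining_function S p U f)"

text \<open>The derivative of a local defining function at \<open>p\<close> is a multiple of the inner product
  with \<open>n\<close>; the orientation of \<open>n\<close> is left open.\<close>

definition unit_normal :: "'a::euclidean_space set \<Rightarrow> 'a \<Rightarrow> 'a \<Rightarrow> bool" where
  "unit_normal S p n \<longleftrightarrow> p \<in> S \<and> norm n = 1 \<and>
     (\<exists>U f c. local_defining_function S p U f \<and>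
        (\<forall>v. frechet_derivative f (at p) v = c * (n \<bullet> v)))"


section \<open>The lifted obstacles\<close>

definition lattice_vec :: "int ^ 'm \<Rightarrow> real ^ 'm" where
  "lattice_vec k = (\<chi> i. of_int (k $ i))"

text \<open>Throughout, \<open>B\<close> is the lifted obstacle with index \<open>0\<close>.\<close>

definition obstacle :: "(real ^ 'm) set \<Rightarrow> int ^ 'm \<Rightarrow> (real ^ 'm) set" where
  "obstacle B k = (\<lambda>x. x + lattice_vec k) ` B"

definition strictly_convex :: "'a::euclidean_space set \<Rightarrow> bool" where
  "strictly_convex S \<longleftrightarrow> convex S \<and>
     (\<forall>a b. a \<noteq> b \<longrightarrow> \<not> closed_segment a b \<subseteq> frontier S)"

definition billiard_obstacle :: "(real ^ 'm) set \<Rightarrow> bool" where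
  "billiard_obstacle B \<longleftrightarrow> compact B \<and> interior B \<noteq> {} \<and>
     smooth_hypersurface (frontier B) \<and> strictly_convex B \<and>
     (\<forall>k l. k \<noteq> l \<longrightarrow> obstacle B k \<inter> obstacle B l = {})"

text \<open>The lifting is normalised so that the ball containing the obstacle with index \<open>k\<close>
  is centred at \<open>k\<close>.\<close>

definition small_obstacle :: "(real ^ 'm) set \<Rightarrow> bool" where
  "small_obstacle B \<longleftrightarrow> (\<exists>r < sqrt 2 / 4. B \<subseteq> cball 0 r)"


section \<open>Admissible sequences\<close>

definition between :: "(real ^ 'm) set \<Rightarrow> int ^ 'm \<Rightarrow> int ^ 'm \<Rightarrow> int ^ 'm \<Rightarrow> bool" where
  "between B k i j \<longleftrightarrow> k \<noteq> i \<and> k \<noteq> j \<and>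
     obstacle B k \<inter> convex hull (obstacle B i \<union> obstacle B j) \<noteq> {}"

text \<open>A finite sequence \<open>k 0, \<dots>, k s\<close>; the values of \<open>k\<close> beyond \<open>s\<close> are irrelevant.\<close>

definition admissible :: "(real ^ 'm) set \<Rightarrow> nat \<Rightarrow> (nat \<Rightarrow> int ^ 'm) \<Rightarrow> bool" where
  "admissible B s k \<longleftrightarrow> k 0 = 0 \<and>
     (\<forall>n. n + 1 \<le> s \<longrightarrow> k (n + 1) \<noteq> k n) \<and>
     (\<forall>n. n + 1 \<le> s \<longrightarrow> \<not> (\<exists>l. between B l (k n) (k (n + 1)))) \<and>
     (\<forall>n. n + 2 \<le> s \<longrightarrow> \<not> between B (k (n + 1)) (k n) (k (n + 2)))"


section \<open>Trajectory pieces and the admissible rotation set\<close>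

text \<open>Here \<open>u\<close> and \<open>w\<close> are the incoming and outgoing unit velocities. The requirement
  \<open>u \<bullet> n \<noteq> 0\<close> excludes tangencies.\<close>

definition reflects :: "(real ^ 'm) set \<Rightarrow> real ^ 'm \<Rightarrow> real ^ 'm \<Rightarrow> real ^ 'm \<Rightarrow> bool" where
  "reflects S p u w \<longleftrightarrow>
     (\<exists>n. unit_normal S p n \<and> u \<bullet> n \<noteq> 0 \<and> w = u - (2 * (u \<bullet> n)) *\<^sub>R n)"

text \<open>A unit speed trajectory piece is given by its starting point \<open>z 0\<close>, its consecutive
  reflection points \<open>z 1, \<dots>, z (s - 1)\<close> and its end point \<open>z s\<close>; since tangencies are not
  reflections, the edges may touch further obstacles. The lattice vector \<open>q\<close> is the
  translation that brings the type \<open>k\<close> to \<open>k 0 = 0\<close>.\<close>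

definition trajectory_of_type ::
    "(real ^ 'm) set \<Rightarrow> nat \<Rightarrow> (nat \<Rightarrow> int ^ 'm) \<Rightarrow> (nat \<Rightarrow> real ^ 'm) \<Rightarrow> bool" where
  "trajectory_of_type B s k z \<longleftrightarrow>
     (\<exists>q. (\<forall>i\<le>s. z i \<in> frontier (obstacle B (k i + q))) \<and>
          (\<forall>i<s. \<forall>l. closed_segment (z i) (z (i + 1)) \<inter> interior (obstacle B l) = {}) \<and>
          (\<forall>i. 0 < i \<and> i < s \<longrightarrow>
             reflects (frontier (obstacle B (k i + q))) (z i)
               (sgn (z i - z (i - 1))) (sgn (z (i + 1) - z i))))"

definition admissible_piece ::
    "(real ^ 'm) set \<Rightarrow> real ^ 'm \<Rightarrow> real ^ 'm \<Rightarrow> real \<Rightarrow> bool" where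
  "admissible_piece B x y t \<longleftrightarrow>
     (\<exists>s k z. admissible B s k \<and> trajectory_of_type B s k z \<and>
        z 0 = x \<and> z s = y \<and> t = (\<Sum>i<s. dist (z i) (z (i + 1))))"

definition admissible_rotation_set :: "(real ^ 'm) set \<Rightarrow> (real ^ 'm) set" where
  "admissible_rotation_set B =
     {w. \<exists>x y t. (\<forall>n. admissible_piece B (x n) (y n) (t n)) \<and>
           filterlim t at_top sequentially \<and>
           (\<lambda>n. (y n - x n) /\<^sub>R t n) \<longlonglongrightarrow> w}"

end

theory Submission
  imports Defs
begin

text \<open>
A trajectory piece is a critical point of the path length among the paths that visit the obstacles
of its type in the prescribed order, and the path length is a convex function of the vertices.
Therefore each piece is a shortest path of its type up to the freedom at its two end points
(\<open>trajectory_nearly_shortest\<close>), and its displacement and length are determined by the type up to a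
bounded error. Conversely, a shortest path of admissible type exists by compactness and is a
trajectory piece (\<open>shortest_path_is_trajectory\<close>). The geometric input to both directions is
\<open>outward_normal\<close>: a convex body with smooth boundary lies on one side of each tangent hyperplane,
and every direction that points strictly to this side enters its interior.

Two admissible types can be joined to an admissible type by two unit steps along different coordinate
axes (\<open>exists_linking_steps\<close>, \<open>admissible_link\<close>). Here the smallness of the obstacle is used: if a
path in the lattice turns by at least ninety degrees at a node, then the obstacle at this node is not
between its neighbours (\<open>not_between_acute\<close>), and with two axes available one can always turn so much.

Together, the pairs consisting of the displacement and the length of an admissible piece can be added
up to a bounded error (\<open>approximately_additive_pieces\<close>). The rotation set consists of the limits of
the quotients as the length tends to infinity. Repeating two long pieces in suitable
proportions realises every convex combination of their directions approximately, because the
errors are negligible compared to the lengths; this is \<open>convex_limit_directions\<close>.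
\<close>


section \<open>Normals of convex bodies with smooth boundary\<close>

text \<open>Let \<open>d\<close> and \<open>e = x - p\<close> point to the same side of the tangent hyperplane at \<open>p\<close>. A local defining
function \<open>f\<close> with \<open>f p = 0\<close> is, near \<open>p\<close>, a linear function up to an error of smaller order, so for
small \<open>t\<close> it has no zero on the segment from \<open>p + t *\<^sub>R d\<close> to \<open>p + t *\<^sub>R e\<close>. This segment is thus
disjoint from the frontier, and it contains a point of \<open>C\<close>, so it lies in the interior.\<close>

lemma lies_inside_on_same_side:
  fixes C :: "'a::euclidean_space set"
  assumes "convex C" and normal: "unit_normal (frontier C) p n"
    and x: "x \<in> interior C" and side: "0 < (n \<bullet> d) * (n \<bullet> (x - p))"
  shows "\<exists>t0>0. \<forall>t. 0 < t \<and> t < t0 \<longrightarrow> p + t *\<^sub>R d \<in> interior C"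
proof -
  obtain U f c where f: "local_defining_function (frontier C) p U f"
    and grad: "\<And>v. frechet_derivative f (at p) v = c * (n \<bullet> v)"
    and pC: "p \<in> frontier C"
    using normal unfolding unit_normal_def by blast
  have U: "open U" "p \<in> U" and zeros: "frontier C \<inter> U = {x \<in> U. f x = 0}"
    using f unfolding local_defining_function_def by auto
  have "Ck_on (Suc 0) U f"
    using f unfolding local_defining_function_def smooth_on_def by blast
  then have "f differentiable (at p)"
    using U by simp
  then have deriv: "(f has_derivative (\<lambda>v. c * (n \<bullet> v))) (at p)"
    using grad frechet_derivative_works[of f "at p"] by presburger
  obtain v where "frechet_derivative f (at p) v \<noteq> 0"
    using f U unfolding local_defining_function_def by blast
  then have c: "c \<noteq> 0"
    using grad by auto
  have fp: "f p = 0"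
    using zeros pC U by blast
  define e where "e = x - p"
  \<comment> \<open>For a convex combination \<open>w\<close> of \<open>d\<close> and \<open>e\<close>, the number \<open>m\<close> bounds \<open>\<bar>n \<bullet> w\<bar>\<close> from below
    and \<open>M\<close> bounds \<open>norm w\<close> from above; \<open>eps\<close> makes the error at most half of the linear term.\<close>
  define m where "m = min \<bar>n \<bullet> d\<bar> \<bar>n \<bullet> e\<bar>"
  define M where "M = norm d + norm e"
  have nz: "n \<bullet> d \<noteq> 0" "n \<bullet> e \<noteq> 0"
    using side unfolding e_def by auto
  have m: "m > 0"
    using nz unfolding m_def by auto
  have "e \<noteq> 0"
    using nz by auto
  then have M: "M > 0"
    unfolding M_def by (simp add: add_nonneg_pos)
  define eps where "eps = \<bar>c\<bar> * m / (2 * M)"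
  have eps: "eps > 0"
    using c m M unfolding eps_def by simp
  obtain del where del: "del > 0"
    and approx: "\<And>y. norm (y - p) < del \<Longrightarrow>
        norm (f y - f p - c * (n \<bullet> (y - p))) \<le> eps * norm (y - p)"
    using deriv eps unfolding has_derivative_at_alt by blast
  obtain r where r: "r > 0" "ball p r \<subseteq> U"
    using U open_contains_ball by blast
  define t0 where "t0 = min 1 (min del r / M)"
  have t0: "t0 > 0"
    using del r M unfolding t0_def by simp
  have "p + t *\<^sub>R d \<in> interior C" if t: "0 < t" "t < t0" for t
  proof -
    have t1: "t < 1" and tM: "t * M < del" "t * M < r"
      using t M unfolding t0_def by (auto simp: field_simps)
    have off: "y \<notin> frontier C" if y: "y \<in> closed_segment (p + t *\<^sub>R d) (p + t *\<^sub>R e)" for y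
    proof -
      obtain a where a: "0 \<le> a" "a \<le> 1"
        and ya: "y = (1 - a) *\<^sub>R (p + t *\<^sub>R d) + a *\<^sub>R (p + t *\<^sub>R e)"
        using y unfolding in_segment by blast
      define w where "w = (1 - a) *\<^sub>R d + a *\<^sub>R e"
      have yw: "y - p = t *\<^sub>R w"
        unfolding ya w_def by (simp add: algebra_simps)
      have "norm w \<le> (1 - a) * norm d + a * norm e"
        unfolding w_def using a by (intro norm_triangle_le) simp
      also have "\<dots> \<le> M"
        unfolding M_def using a by (intro add_mono mult_left_le_one_le) auto
      finally have "norm w \<le> M" .
      then have norm_y: "norm (y - p) \<le> t * M"
        unfolding yw using t by simp
      have "m \<le> \<bar>n \<bullet> w\<bar>"
      proof -
        have "\<bar>n \<bullet> w\<bar> = (1 - a) * \<bar>n \<bullet> d\<bar> + a * \<bar>n \<bullet> e\<bar>"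
        proof (cases "n \<bullet> d > 0")
          case True
          then have "n \<bullet> e > 0"
            using side unfolding e_def by (simp add: zero_less_mult_iff)
          then show ?thesis
            using True a by (simp add: w_def inner_add_right abs_of_nonneg)
        next
          case False
          then have "n \<bullet> d < 0" "n \<bullet> e < 0"
            using side nz unfolding e_def by (auto simp: zero_less_mult_iff)
          then have "n \<bullet> w \<le> 0"
            using a unfolding w_def
            by (simp add: inner_add_right add_nonpos_nonpos mult_nonneg_nonpos)
          then show ?thesis
            using \<open>n \<bullet> d < 0\<close> \<open>n \<bullet> e < 0\<close> by (simp add: w_def inner_add_right abs_of_nonpos)
        qed
        moreover have "(1 - a) * m \<le> (1 - a) * \<bar>n \<bullet> d\<bar>" "a * m \<le> a * \<bar>n \<bullet> e\<bar>"
          using a unfolding m_def by (auto intro!: mult_left_mono)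
        ultimately show ?thesis
          by (simp add: algebra_simps)
      qed
      then have big: "\<bar>c\<bar> * m * t \<le> \<bar>c * (n \<bullet> (y - p))\<bar>"
        unfolding yw using t mult_right_mono[of m "\<bar>n \<bullet> w\<bar>" "\<bar>c\<bar>"]
        by (simp add: abs_mult mult_ac)
      have "norm (f y - f p - c * (n \<bullet> (y - p))) \<le> eps * norm (y - p)"
        using approx norm_y tM by force
      also have "\<dots> \<le> eps * (t * M)"
        using norm_y eps by simp
      also have "\<dots> = \<bar>c\<bar> * m * t / 2"
        unfolding eps_def using M by (simp add: field_simps)
      also have "\<dots> < \<bar>c * (n \<bullet> (y - p))\<bar>"
        using big c m t by (smt (verit) mult_pos_pos field_sum_of_halves zero_less_abs_iff)
      finally have "f y \<noteq> 0"
        using fp by auto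
      moreover have "y \<in> U"
        using norm_y tM r by (auto simp: dist_norm norm_minus_commute subset_iff)
      ultimately show ?thesis
        using zeros by blast
    qed
    have "p \<in> closure C"
      using pC unfolding frontier_def by blast
    then have "p - t *\<^sub>R (p - x) \<in> interior C"
      using mem_interior_closure_convex_shrink[OF \<open>convex C\<close> x] t t1 by simp
    then have "p + t *\<^sub>R e \<in> C"
      unfolding e_def using interior_subset by (auto simp: algebra_simps)
    moreover have "connected (closed_segment (p + t *\<^sub>R d) (p + t *\<^sub>R e))"
      by simp
    ultimately have "closed_segment (p + t *\<^sub>R d) (p + t *\<^sub>R e) - C = {}"
      using connected_Int_frontier[of "closed_segment (p + t *\<^sub>R d) (p + t *\<^sub>R e)" C] off
      by blast
    then have "p + t *\<^sub>R d \<in> C"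
      by blast
    then show ?thesis
      using off[of "p + t *\<^sub>R d"] closure_subset unfolding frontier_def by auto
  qed
  then show ?thesis
    using t0 by blast
qed

text \<open>The body cannot have points on both sides of the tangent hyperplane: moving from \<open>p\<close> a little in both
directions along the normal would then lead into the interior, and so would their midpoint, which
is \<open>p\<close>. Hence \<open>C\<close> lies on one side, and every direction that points strictly to that side enters
the interior.\<close>

lemma outward_normal:
  fixes C :: "'a::euclidean_space set"
  assumes "convex C" "interior C \<noteq> {}" and normal: "unit_normal (frontier C) p n"
  obtains \<nu> where "\<nu> = n \<or> \<nu> = - n" "\<And>y. y \<in> C \<Longrightarrow> \<nu> \<bullet> (y - p) \<le> 0"
    "\<And>d. \<nu> \<bullet> d < 0 \<Longrightarrow> \<exists>t0>0. \<forall>t. 0 < t \<and> t < t0 \<longrightarrow> p + t *\<^sub>R d \<in> interior C"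
proof -
  have n: "norm n = 1" and p: "p \<notin> interior C"
    using normal unfolding unit_normal_def frontier_def by auto
  then have "n \<noteq> 0"
    by auto
  have off_tangent: "\<exists>x'\<in>interior C. n \<bullet> (x' - p) \<noteq> 0"
  proof -
    obtain x where x: "x \<in> interior C"
      using assms by blast
    then obtain r where r: "r > 0" "ball x r \<subseteq> interior C"
      by (meson open_contains_ball open_interior)
    have "x + (r / 2) *\<^sub>R n \<in> interior C"
      using r n by (auto simp: dist_norm subset_iff)
    moreover have "n \<bullet> (x + (r / 2) *\<^sub>R n - p) = n \<bullet> (x - p) + r / 2"
      using n by (simp add: inner_diff_right inner_add_right dot_square_norm)
    ultimately show ?thesis
      using x r by (cases "n \<bullet> (x - p) = 0") force+
  qed
  then obtain x where x: "x \<in> interior C" "n \<bullet> (x - p) \<noteq> 0"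
    by blast
  define \<nu> where "\<nu> = (if n \<bullet> (x - p) < 0 then n else - n)"
  have \<nu>x: "\<nu> \<bullet> (x - p) < 0" and \<nu>n: "\<nu> = n \<or> \<nu> = - n"
    using x unfolding \<nu>_def by auto
  have sign: "(\<nu> \<bullet> a) * (\<nu> \<bullet> b) = (n \<bullet> a) * (n \<bullet> b)" for a b
    using \<nu>n by auto
  have inside: "\<exists>t0>0. \<forall>t. 0 < t \<and> t < t0 \<longrightarrow> p + t *\<^sub>R d \<in> interior C"
    if "z \<in> interior C" "0 < (\<nu> \<bullet> d) * (\<nu> \<bullet> (z - p))" for z d
    using lies_inside_on_same_side[OF \<open>convex C\<close> normal, of z d] that sign by simp
  have "\<nu> \<bullet> (y - p) \<le> 0" if y: "y \<in> C" for y
  proof (rule ccontr)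
    assume "\<not> ?thesis"
    then have pos: "\<nu> \<bullet> (y - p) > 0"
      by simp
    have "y \<in> closure (interior C)"
      using y assms convex_closure_interior closure_subset by blast
    moreover have "open {z. \<nu> \<bullet> z > \<nu> \<bullet> p}"
      by (simp add: open_halfspace_gt)
    ultimately obtain z where z: "z \<in> interior C" "\<nu> \<bullet> z > \<nu> \<bullet> p"
      using pos open_Int_closure_eq_empty[of "{z. \<nu> \<bullet> z > \<nu> \<bullet> p}" "interior C"]
      by (auto simp: inner_diff_right)
    have \<nu>\<nu>: "\<nu> \<bullet> \<nu> > 0"
      using \<nu>n \<open>n \<noteq> 0\<close> by auto
    obtain t1 where t1: "t1 > 0" "\<forall>t. 0 < t \<and> t < t1 \<longrightarrow> p + t *\<^sub>R \<nu> \<in> interior C"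
      using inside[of z \<nu>] z \<nu>\<nu> by (auto simp: inner_diff_right)
    obtain t2 where t2: "t2 > 0" "\<forall>t. 0 < t \<and> t < t2 \<longrightarrow> p + t *\<^sub>R (- \<nu>) \<in> interior C"
      using inside[of x "- \<nu>"] x \<nu>\<nu> \<nu>x by (auto simp: zero_less_mult_iff mult_less_0_iff)
    define t where "t = min t1 t2 / 2"
    have t: "t > 0" "t < t1" "t < t2"
      using t1 t2 unfolding t_def by auto
    have "(1/2) *\<^sub>R (p + t *\<^sub>R \<nu>) + (1/2) *\<^sub>R (p + t *\<^sub>R (- \<nu>)) \<in> interior C"
      using t t1 t2 convex_interior[OF \<open>convex C\<close>] by (intro convexD) auto
    moreover have "(1/2) *\<^sub>R (p + t *\<^sub>R \<nu>) + (1/2) *\<^sub>R (p + t *\<^sub>R (- \<nu>)) = p"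
      by (simp add: algebra_simps flip: scaleR_add_left)
    ultimately show False
      using p by simp
  qed
  moreover have "\<exists>t0>0. \<forall>t. 0 < t \<and> t < t0 \<longrightarrow> p + t *\<^sub>R d \<in> interior C" if "\<nu> \<bullet> d < 0" for d
    using inside[of x d] x \<nu>x that by (simp add: mult_neg_neg)
  ultimately show ?thesis
    using that \<nu>n by blast
qed

lemma unit_normal_exists:
  fixes S :: "'a::euclidean_space set"
  assumes "smooth_hypersurface S" "p \<in> S"
  shows "\<exists>n. unit_normal S p n"
proof -
  obtain U f where f: "local_defining_function S p U f"
    using assms unfolding smooth_hypersurface_def by blast
  let ?F = "frechet_derivative f (at p)"
  have U: "p \<in> U" and "Ck_on (Suc 0) U f"
    using f unfolding local_defining_function_def smooth_on_def by blast+
  then have "f differentiable (at p)"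
    by simp
  then have "linear ?F"
    using frechet_derivative_works has_derivative_linear by blast
  then have grad: "?F v = adjoint ?F 1 \<bullet> v" for v
    using adjoint_works[of ?F v 1] by (simp add: inner_commute)
  obtain v where "?F v \<noteq> 0"
    using f U unfolding local_defining_function_def by blast
  then have "adjoint ?F 1 \<noteq> 0"
    using grad by auto
  then have "norm (sgn (adjoint ?F 1)) = 1"
    "\<And>v. ?F v = norm (adjoint ?F 1) * (sgn (adjoint ?F 1) \<bullet> v)"
    using grad by (auto simp: norm_sgn sgn_div_norm)
  then show ?thesis
    using f assms(2) unfolding unit_normal_def by blast
qed

text \<open>The lifted obstacles are translates of one body. The Frechet derivative is chosen among all
derivatives at a point, so its compatibility with translations is derived from an equivalence of the
defining predicates; this also covers points at which \<open>f\<close> is not differentiable.\<close>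

lemma has_derivative_translate_iff:
  fixes f :: "'a::real_normed_vector \<Rightarrow> real"
  shows "((\<lambda>x. f (x - a)) has_derivative F) (at x) \<longleftrightarrow> (f has_derivative F) (at (x - a))"
proof
  assume "((\<lambda>x. f (x - a)) has_derivative F) (at x)"
  then have "(((\<lambda>x. f (x - a)) \<circ> (\<lambda>y. y + a)) has_derivative F \<circ> (\<lambda>h. h)) (at (x - a))"
    by (intro diff_chain_at) (auto intro!: derivative_eq_intros)
  then show "(f has_derivative F) (at (x - a))"
    by (simp add: o_def)
next
  assume "(f has_derivative F) (at (x - a))"
  then have "((f \<circ> (\<lambda>y. y - a)) has_derivative F \<circ> (\<lambda>h. h)) (at x)"
    by (intro diff_chain_at) (auto intro!: derivative_eq_intros)
  then show "((\<lambda>x. f (x - a)) has_derivative F) (at x)"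
    by (simp add: o_def)
qed

lemma frechet_derivative_translate:
  fixes f :: "'a::real_normed_vector \<Rightarrow> real"
  shows "frechet_derivative (\<lambda>x. f (x - a)) (at x) = frechet_derivative f (at (x - a))"
  unfolding frechet_derivative_def has_derivative_translate_iff ..

lemma Ck_on_translate:
  "Ck_on j U f \<Longrightarrow> Ck_on j ((+) a ` U) (\<lambda>x. f (x - a))"
proof (induction j arbitrary: f)
  case 0
  then show ?case
    by (auto intro!: continuous_on_compose2[of U f] continuous_intros)
next
  case (Suc j)
  have "(\<lambda>x. f (x - a)) differentiable (at (a + u))" if "u \<in> U" for u
    using Suc.prems that by (simp add: differentiable_def has_derivative_translate_iff)
  moreover have "Ck_on j ((+) a ` U) (\<lambda>x. frechet_derivative f (at (x - a)) v)" for v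
    using Suc.prems Suc.IH[of "\<lambda>x. frechet_derivative f (at x) v"] by simp
  ultimately show ?case
    by (simp add: frechet_derivative_translate)
qed

lemma smooth_hypersurface_translate:
  assumes "smooth_hypersurface S"
  shows "smooth_hypersurface ((+) a ` S)"
  unfolding smooth_hypersurface_def
proof
  fix p
  assume "p \<in> (+) a ` S"
  then obtain s where s: "s \<in> S" "p = a + s"
    by blast
  then obtain U f where "local_defining_function S s U f"
    using assms unfolding smooth_hypersurface_def by blast
  then have "local_defining_function ((+) a ` S) p ((+) a ` U) (\<lambda>x. f (x - a))"
    unfolding local_defining_function_def smooth_on_def s frechet_derivative_translate
    by (auto simp: Ck_on_translate open_translation)
  then show "\<exists>U f. local_defining_function ((+) a ` S) p U f"
    by blast
qed


section \<open>Shortest paths through a sequence of convex sets\<close>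

definition path_length :: "nat \<Rightarrow> (nat \<Rightarrow> 'a::metric_space) \<Rightarrow> real" where
  "path_length s z = (\<Sum>i<s. dist (z i) (z (i + 1)))"

text \<open>The gradient of the path length with respect to the \<open>i\<close>-th vertex. An end point has a single edge, so
the velocity before the start and after the end counts as \<open>0\<close>.\<close>

definition kink :: "nat \<Rightarrow> (nat \<Rightarrow> 'a::real_normed_vector) \<Rightarrow> nat \<Rightarrow> 'a" where
  "kink s z i = (if i = 0 then 0 else sgn (z i - z (i - 1)))
     - (if i = s then 0 else sgn (z (i + 1) - z i))"

definition shortest_path :: "nat \<Rightarrow> (nat \<Rightarrow> 'a::metric_space set) \<Rightarrow> (nat \<Rightarrow> 'a) \<Rightarrow> bool" where
  "shortest_path s C z \<longleftrightarrow> (\<forall>i\<le>s. z i \<in> C i) \<and>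
     (\<forall>y. (\<forall>i\<le>s. y i \<in> C i) \<longrightarrow> path_length s z \<le> path_length s y)"

text \<open>Summation by parts. The left side is the differential of the path length in terms of the vertices,
the right side the same differential in terms of the edges.\<close>

lemma sum_kink_inner:
  fixes z h :: "nat \<Rightarrow> 'a::real_inner"
  shows "(\<Sum>i\<le>s. kink s z i \<bullet> h i) = (\<Sum>i<s. sgn (z (i + 1) - z i) \<bullet> (h (i + 1) - h i))"
proof -
  have "(\<Sum>i\<le>s. (if i = 0 then 0 else sgn (z i - z (i - 1))) \<bullet> h i)
      = (\<Sum>i<s. sgn (z (i + 1) - z i) \<bullet> h (i + 1))"
    by (simp add: sum.atMost_shift)
  moreover have "(\<Sum>i\<le>s. (if i = s then 0 else sgn (z (i + 1) - z i)) \<bullet> h i)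
      = (\<Sum>i<s. sgn (z (i + 1) - z i) \<bullet> h i)"
    by (simp flip: lessThan_Suc_atMost)
  ultimately show ?thesis
    by (simp add: kink_def inner_diff_left inner_diff_right sum_subtractf)
qed

lemma inner_sgn_self: "sgn v \<bullet> v = norm v" for v :: "'a::real_inner"
  by (cases "v = 0") (auto simp: sgn_div_norm dot_square_norm power2_eq_square)

text \<open>The path length is a convex function of the vertices, so it lies above its linearisation at any
path. Hence a path at which the linearisation is nonnegative is globally shortest. The inequality
also holds for degenerate edges, whose \<open>sgn\<close> is \<open>0\<close>.\<close>

lemma path_length_above_tangent:
  fixes y z :: "nat \<Rightarrow> 'a::real_inner"
  shows "path_length s z + (\<Sum>i\<le>s. kink s z i \<bullet> (y i - z i)) \<le> path_length s y"
proof -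
  have step: "dist (z i) (z (i + 1)) + sgn (z (i + 1) - z i) \<bullet> ((y (i + 1) - z (i + 1)) - (y i - z i))
      \<le> dist (y i) (y (i + 1))" for i
  proof -
    let ?a = "sgn (z (i + 1) - z i)"
    have "dist (z i) (z (i + 1)) + ?a \<bullet> ((y (i + 1) - z (i + 1)) - (y i - z i))
        = ?a \<bullet> (y (i + 1) - y i)"
      using inner_sgn_self[of "z (i + 1) - z i"]
      by (simp add: dist_norm norm_minus_commute inner_diff_right)
    also have "\<dots> \<le> norm ?a * norm (y (i + 1) - y i)"
      by (rule norm_cauchy_schwarz)
    also have "\<dots> \<le> norm (y (i + 1) - y i)"
      by (intro mult_left_le_one_le) (auto simp: norm_sgn)
    finally show ?thesis
      by (simp add: dist_norm norm_minus_commute)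
  qed
  show ?thesis
    unfolding sum_kink_inner path_length_def
    by (subst sum.distrib[symmetric]) (intro sum_mono step)
qed

lemma path_length_has_derivative:
  fixes z h :: "nat \<Rightarrow> 'a::real_inner"
  assumes "\<And>i. i < s \<Longrightarrow> z i \<noteq> z (i + 1)"
  shows "((\<lambda>t. path_length s (\<lambda>i. z i + t *\<^sub>R h i)) has_real_derivative
      (\<Sum>i\<le>s. kink s z i \<bullet> h i)) (at 0)"
  unfolding path_length_def sum_kink_inner
proof (rule DERIV_sum)
  fix i
  assume "i \<in> {..<s}"
  define v where "v = z (i + 1) - z i"
  define w where "w = h (i + 1) - h i"
  have "v \<noteq> 0"
    using assms[of i] \<open>i \<in> {..<s}\<close> unfolding v_def by auto
  then have "(norm has_derivative (\<lambda>h. h \<bullet> sgn v)) (at (v + 0 *\<^sub>R w))"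
    using has_derivative_norm by auto
  moreover have "((\<lambda>t. v + t *\<^sub>R w) has_derivative (\<lambda>t. t *\<^sub>R w)) (at 0)"
    by (auto intro!: derivative_eq_intros)
  ultimately have "((norm \<circ> (\<lambda>t. v + t *\<^sub>R w)) has_derivative ((\<lambda>h. h \<bullet> sgn v) \<circ> (\<lambda>t. t *\<^sub>R w))) (at 0)"
    by (intro diff_chain_at) auto
  moreover have "dist (z i + t *\<^sub>R h i) (z (i + 1) + t *\<^sub>R h (i + 1)) = norm (v + t *\<^sub>R w)" for t
    unfolding v_def w_def dist_norm by (subst norm_minus_commute) (simp add: algebra_simps)
  ultimately show "((\<lambda>t. dist (z i + t *\<^sub>R h i) (z (i + 1) + t *\<^sub>R h (i + 1))) has_real_derivative
      sgn (z (i + 1) - z i) \<bullet> (h (i + 1) - h i)) (at 0)"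
    unfolding has_field_derivative_def v_def[symmetric] w_def[symmetric]
    by (simp add: o_def inner_commute mult_commute_abs)
qed

text \<open>First-order optimality: moving one vertex towards another point of its set does not shorten the path
to first order.\<close>

lemma shortest_path_kink:
  fixes z :: "nat \<Rightarrow> 'a::real_inner"
  assumes short: "shortest_path s C z" and "convex (C i)"
    and "\<And>i. i < s \<Longrightarrow> z i \<noteq> z (i + 1)" and i: "i \<le> s" and y: "y \<in> C i"
  shows "0 \<le> kink s z i \<bullet> (y - z i)"
proof (rule ccontr)
  define h where "h = (\<lambda>j. if j = i then y - z i else 0)"
  let ?f = "\<lambda>t. path_length s (\<lambda>j. z j + t *\<^sub>R h j)"
  assume "\<not> ?thesis"
  moreover have "(\<Sum>j\<le>s. kink s z j \<bullet> h j) = (\<Sum>j\<le>s. if j = i then kink s z i \<bullet> (y - z i) else 0)"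
    unfolding h_def by (intro sum.cong) auto
  ultimately have "(\<Sum>j\<le>s. kink s z j \<bullet> h j) < 0"
    using i by simp
  then obtain d where d: "d > 0" "\<And>t. 0 < t \<Longrightarrow> t < d \<Longrightarrow> ?f (0 + t) < ?f 0"
    using DERIV_neg_dec_right[OF path_length_has_derivative[of s z h, OF assms(3)]] by blast
  define t where "t = min (d / 2) 1"
  have t: "0 < t" "t < d" "t \<le> 1"
    using d unfolding t_def by auto
  have "z j + t *\<^sub>R h j \<in> C j" if "j \<le> s" for j
  proof (cases "j = i")
    case True
    have "(1 - t) *\<^sub>R z i + t *\<^sub>R y \<in> C i"
      using assms(2) short i y t unfolding shortest_path_def by (intro convexD) auto
    then show ?thesis
      unfolding h_def True by (simp add: algebra_simps)
  next
    case False
    then show ?thesis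
      using short that unfolding h_def shortest_path_def by simp
  qed
  then have "?f 0 \<le> ?f t"
    using short unfolding shortest_path_def by simp
  then show False
    using d(2)[of t] t by simp
qed

lemma shortest_path_not_interior:
  fixes z :: "nat \<Rightarrow> 'a::real_inner"
  assumes "shortest_path s C z" "convex (C i)"
    and "\<And>i. i < s \<Longrightarrow> z i \<noteq> z (i + 1)" "i \<le> s" and kink: "kink s z i \<noteq> 0"
  shows "z i \<notin> interior (C i)"
proof
  assume "z i \<in> interior (C i)"
  then obtain r where r: "r > 0" "cball (z i) r \<subseteq> C i"
    unfolding mem_interior_cball by blast
  let ?y = "z i - r *\<^sub>R sgn (kink s z i)"
  have "?y \<in> C i"
    using r by (auto simp: subset_iff dist_norm norm_sgn)
  then have "0 \<le> kink s z i \<bullet> (?y - z i)"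
    using shortest_path_kink assms by metis
  moreover have "kink s z i \<bullet> (?y - z i) = - r * norm (kink s z i)"
    using inner_sgn_self[of "kink s z i"] by (simp add: inner_commute)
  ultimately show False
    using r kink by (simp add: mult_le_0_iff)
qed

lemma inner_diff_neg_of_unit:
  fixes p q :: "'a::real_inner"
  assumes "norm p \<le> 1" "norm q = 1" "p \<noteq> q"
  shows "(p - q) \<bullet> q < 0"
proof -
  have "0 < (p - q) \<bullet> (p - q)"
    using assms by simp
  also have "\<dots> = p \<bullet> p + q \<bullet> q - 2 * (p \<bullet> q)"
    by (simp add: inner_diff_left inner_diff_right inner_commute)
  finally have "2 * (p \<bullet> q) < p \<bullet> p + 1"
    using assms by (simp add: dot_square_norm)
  moreover have "p \<bullet> p \<le> 1"
    using assms by (simp add: dot_square_norm power_le_one)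
  ultimately show ?thesis
    using assms by (simp add: inner_diff_left dot_square_norm)
qed

text \<open>If an edge met the set of one of its end points again, moving this end point along the edge would
shorten the path to first order, since the other velocity at the vertex differs from the velocity
along the edge.\<close>

lemma shortest_path_edge:
  fixes z :: "nat \<Rightarrow> 'a::real_inner"
  assumes short: "shortest_path s C z" and "convex (C i)" "convex (C (i + 1))"
    and distinct: "\<And>i. i < s \<Longrightarrow> z i \<noteq> z (i + 1)" and i: "i < s"
    and kinks: "kink s z i \<noteq> 0" "kink s z (i + 1) \<noteq> 0"
    and x: "x \<in> closed_segment (z i) (z (i + 1))"
  shows "x \<in> C i \<Longrightarrow> x = z i" "x \<in> C (i + 1) \<Longrightarrow> x = z (i + 1)"
proof -
  define w where "w = sgn (z (i + 1) - z i)"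
  define d where "d = norm (z (i + 1) - z i)"
  have w: "norm w = 1" "d > 0" "z (i + 1) - z i = d *\<^sub>R w"
    using distinct[OF i] unfolding w_def d_def by (auto simp: norm_sgn sgn_div_norm)
  obtain t where t: "0 \<le> t" "t \<le> 1" "x = (1 - t) *\<^sub>R z i + t *\<^sub>R z (i + 1)"
    using x unfolding in_segment by blast
  have "x - z i = t *\<^sub>R (z (i + 1) - z i)" "x - z (i + 1) = - ((1 - t) *\<^sub>R (z (i + 1) - z i))"
    unfolding t(3) by (simp_all add: algebra_simps)
  then have x_eq: "x - z i = (t * d) *\<^sub>R w" "x - z (i + 1) = - (((1 - t) * d) *\<^sub>R w)"
    unfolding w(3) by simp_all
  have unit_le: "norm (if P then 0 else sgn v) \<le> 1" for P and v :: 'a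
    by (simp add: norm_sgn)
  show "x = z i" if "x \<in> C i"
  proof -
    define u where "u = (if i = 0 then 0 else sgn (z i - z (i - 1)))"
    have k: "kink s z i = u - w"
      using i unfolding kink_def u_def w_def by simp
    have "0 \<le> kink s z i \<bullet> (x - z i)"
      using shortest_path_kink[of s C z i x] assms that by auto
    then have "0 \<le> (t * d) * ((u - w) \<bullet> w)"
      unfolding k x_eq by simp
    moreover have "(u - w) \<bullet> w < 0"
      using kinks w unit_le unfolding k u_def by (intro inner_diff_neg_of_unit) auto
    ultimately have "t = 0"
      using w t by (auto simp: zero_le_mult_iff mult_le_0_iff)
    then show ?thesis
      using t by simp
  qed
  show "x = z (i + 1)" if "x \<in> C (i + 1)"
  proof -
    define u where "u = (if i + 1 = s then 0 else sgn (z (i + 2) - z (i + 1)))"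
    have k: "kink s z (i + 1) = w - u"
      unfolding kink_def u_def w_def by (simp add: numeral_eq_Suc)
    have "0 \<le> kink s z (i + 1) \<bullet> (x - z (i + 1))"
      using shortest_path_kink[of s C z "i + 1" x] assms that by auto
    then have "0 \<le> ((1 - t) * d) * ((u - w) \<bullet> w)"
      unfolding k x_eq by (simp add: inner_diff_left algebra_simps)
    moreover have "(u - w) \<bullet> w < 0"
      using kinks w unit_le unfolding k u_def by (intro inner_diff_neg_of_unit) auto
    ultimately have "t = 1"
      using w t by (auto simp: zero_le_mult_iff mult_le_0_iff)
    then show ?thesis
      using t by simp
  qed
qed

lemma path_length_cong: "(\<And>i. i \<le> s \<Longrightarrow> y i = z i) \<Longrightarrow> path_length s y = path_length s z"
  unfolding path_length_def by (intro sum.cong) auto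

text \<open>The sets are indexed by all natural numbers, so the space of paths is a compact infinite product;
only the first \<open>s + 1\<close> factors influence the length.\<close>

lemma shortest_path_exists:
  fixes C :: "nat \<Rightarrow> 'a::metric_space set"
  assumes "\<And>i. compact (C i)" "\<And>i. C i \<noteq> {}"
  shows "\<exists>z. shortest_path s C z"
proof -
  let ?P = "Pi\<^sub>E UNIV C"
  have "compactin (product_topology (\<lambda>i. euclidean) UNIV) ?P"
    unfolding compactin_PiE using assms by simp
  then have "compact ?P"
    by (simp add: euclidean_product_topology)
  moreover have "?P \<noteq> {}"
    using assms by (simp add: PiE_eq_empty_iff)
  moreover have "continuous_on ?P (path_length s)"
    unfolding path_length_def
    by (intro continuous_intros continuous_on_subset[OF continuous_on_product_coordinates]) auto
  ultimately obtain z where z: "z \<in> ?P" "\<And>y. y \<in> ?P \<Longrightarrow> path_length s z \<le> path_length s y"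
    using continuous_attains_inf by metis
  have "path_length s z \<le> path_length s y" if y: "\<forall>i\<le>s. y i \<in> C i" for y
  proof -
    let ?y = "\<lambda>i. if i \<le> s then y i else z i"
    have "?y \<in> ?P"
      using z y by auto
    then have "path_length s z \<le> path_length s ?y"
      by (rule z)
    also have "\<dots> = path_length s y"
      by (intro path_length_cong) simp
    finally show ?thesis .
  qed
  then show ?thesis
    using z unfolding shortest_path_def by (intro exI[of _ z]) auto
qed

text \<open>First-order optimality at \<open>p\<close> makes \<open>u - w\<close> nonnegative on all directions that enter \<open>C\<close>, hence on an
open half space, so \<open>u - w\<close> is a multiple of the normal. Since \<open>u\<close> and \<open>w\<close> are different unit vectors,
the factor is the one of the reflection law, and it does not vanish.\<close>

lemma reflection_of_minimality:
  fixes C :: "'a::euclidean_space set"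
  assumes C: "convex C" "interior C \<noteq> {}" and normal: "unit_normal (frontier C) p n"
    and unit: "norm u = 1" "norm w = 1" "u \<noteq> w"
    and first_order: "\<And>y. y \<in> C \<Longrightarrow> 0 \<le> (u - w) \<bullet> (y - p)"
  shows "u \<bullet> n \<noteq> 0 \<and> w = u - (2 * (u \<bullet> n)) *\<^sub>R n"
proof -
  obtain \<nu> where \<nu>: "\<nu> = n \<or> \<nu> = - n"
    and inside: "\<And>d. \<nu> \<bullet> d < 0 \<Longrightarrow> \<exists>t0>0. \<forall>t. 0 < t \<and> t < t0 \<longrightarrow> p + t *\<^sub>R d \<in> interior C"
    using outward_normal[OF C normal] by metis
  have "norm n = 1"
    using normal unfolding unit_normal_def by blast
  then have \<nu>\<nu>: "\<nu> \<bullet> \<nu> = 1"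
    using \<nu> by (auto simp: dot_square_norm)
  define g where "g = u - w"
  define c where "c = - (g \<bullet> \<nu>)"
  define h where "h = g + c *\<^sub>R \<nu>"
  have half_space: "0 \<le> g \<bullet> d" if d: "\<nu> \<bullet> d < 0" for d
  proof -
    obtain t0 where t0: "t0 > 0" "\<forall>t. 0 < t \<and> t < t0 \<longrightarrow> p + t *\<^sub>R d \<in> interior C"
      using inside d by blast
    then have "p + (t0 / 2) *\<^sub>R d \<in> interior C"
      by simp
    then have "p + (t0 / 2) *\<^sub>R d \<in> C"
      using interior_subset by blast
    then have "0 \<le> g \<bullet> ((t0 / 2) *\<^sub>R d)"
      using first_order[of "p + (t0 / 2) *\<^sub>R d"] unfolding g_def by simp
    then show ?thesis
      using t0 by (simp add: zero_le_mult_iff)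
  qed
  have h\<nu>: "h \<bullet> \<nu> = 0"
    unfolding h_def c_def using \<nu>\<nu> by (simp add: inner_diff_left)
  \<comment> \<open>The tangential part \<open>h\<close> of \<open>g\<close> vanishes: test \<open>g\<close> with directions that are almost \<open>- h\<close>.\<close>
  have bound: "h \<bullet> h \<le> \<epsilon> * c" if \<epsilon>: "\<epsilon> > 0" for \<epsilon>
  proof -
    have "\<nu> \<bullet> (- \<epsilon> *\<^sub>R \<nu> - h) < 0"
      using \<epsilon> \<nu>\<nu> h\<nu> by (simp add: inner_diff_right inner_commute)
    then have "0 \<le> g \<bullet> (- \<epsilon> *\<^sub>R \<nu> - h)"
      by (rule half_space)
    also have "\<dots> = \<epsilon> * c - h \<bullet> h"
    proof -
      have "g \<bullet> h = h \<bullet> h"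
        using h\<nu> unfolding h_def by (simp add: inner_add_left inner_commute)
      then show ?thesis
        unfolding c_def by (simp add: inner_diff_right)
    qed
    finally show ?thesis
      by simp
  qed
  have "h = 0"
  proof (rule ccontr)
    assume "h \<noteq> 0"
    then have hh: "0 < h \<bullet> h"
      by simp
    then have "0 < c"
      using bound[of 1] by linarith
    then show False
      using bound[of "h \<bullet> h / (2 * c)"] hh by simp
  qed
  then have w: "w = u + c *\<^sub>R \<nu>"
    unfolding h_def g_def by (simp add: algebra_simps)
  have c0: "c \<noteq> 0"
    using w unit by auto
  have "w \<bullet> w = u \<bullet> u + c * (2 * (u \<bullet> \<nu>) + c)"
    unfolding w using \<nu>\<nu> by (simp add: inner_add_left inner_add_right inner_commute algebra_simps)
  then have "c = - 2 * (u \<bullet> \<nu>)"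
    using unit c0 by (simp add: dot_square_norm)
  then show ?thesis
    using w c0 \<nu> by auto
qed

text \<open>The converse. A ray arriving from outside cannot come from the inner side of the tangent hyperplane,
so \<open>u\<close> has a nonpositive product with the outward normal, and so has \<open>y - p\<close>.\<close>

lemma minimality_of_reflection:
  fixes C :: "'a::euclidean_space set"
  assumes C: "convex C" "interior C \<noteq> {}" and normal: "unit_normal (frontier C) p n"
    and outside: "closed_segment a p \<inter> interior C = {}"
    and u: "u = sgn (p - a)" and w: "w = u - (2 * (u \<bullet> n)) *\<^sub>R n" and y: "y \<in> C"
  shows "0 \<le> (u - w) \<bullet> (y - p)"
proof -
  obtain \<nu> where \<nu>: "\<nu> = n \<or> \<nu> = - n" and below: "\<nu> \<bullet> (y - p) \<le> 0"
    and inside: "\<And>d. \<nu> \<bullet> d < 0 \<Longrightarrow> \<exists>t0>0. \<forall>t. 0 < t \<and> t < t0 \<longrightarrow> p + t *\<^sub>R d \<in> interior C"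
    using outward_normal[OF C normal] y by metis
  have "\<nu> \<bullet> u \<le> 0"
  proof (rule ccontr)
    assume "\<not> ?thesis"
    then have "\<nu> \<bullet> (a - p) < 0"
      unfolding u sgn_div_norm
      by (auto simp: inner_diff_right not_le zero_less_mult_iff)
    then obtain t0 where t0: "t0 > 0" "\<forall>t. 0 < t \<and> t < t0 \<longrightarrow> p + t *\<^sub>R (a - p) \<in> interior C"
      using inside by blast
    define t where "t = min (t0 / 2) 1"
    have t: "0 < t" "t < t0" "t \<le> 1"
      using t0 unfolding t_def by auto
    have "p + t *\<^sub>R (a - p) = (1 - t) *\<^sub>R p + t *\<^sub>R a"
      by (simp add: algebra_simps)
    then have "p + t *\<^sub>R (a - p) \<in> closed_segment p a"
      unfolding in_segment using t by (intro exI[of _ t]) auto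
    then show False
      using outside t0 t by (auto simp: closed_segment_commute)
  qed
  moreover have "(u - w) \<bullet> (y - p) = 2 * ((\<nu> \<bullet> u) * (\<nu> \<bullet> (y - p)))"
    unfolding w using \<nu> by (auto simp: inner_commute)
  ultimately show ?thesis
    using below by (simp add: mult_nonpos_nonpos)
qed


section \<open>Lattice vectors and admissible sequences\<close>

lemma lattice_vec_simps [simp]:
  "lattice_vec 0 = 0" "lattice_vec (a + b) = lattice_vec a + lattice_vec b" "lattice_vec (- a) = - lattice_vec a"
  "lattice_vec (a - b) = lattice_vec a - lattice_vec b"
  by (simp_all add: lattice_vec_def vec_eq_iff)

lemma lattice_vec_inner: "lattice_vec a \<bullet> lattice_vec b = of_int (\<Sum>i\<in>UNIV. a $ i * b $ i)"
  by (simp add: lattice_vec_def inner_vec_def)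

lemma lattice_vec_inner_self_ge_1:
  assumes "a \<noteq> 0"
  shows "1 \<le> lattice_vec a \<bullet> lattice_vec a"
proof -
  obtain j where "a $ j \<noteq> 0"
    using assms by (auto simp: vec_eq_iff)
  then have "0 < (\<Sum>i\<in>UNIV. a $ i * a $ i)"
    by (intro sum_pos2[of _ j]) (auto simp: zero_less_mult_iff)
  then show ?thesis
    unfolding lattice_vec_inner by (simp del: of_int_sum)
qed

text \<open>If the nonzero vectors \<open>u\<close> and \<open>v\<close> from \<open>l\<close> to the nodes \<open>i\<close> and \<open>j\<close> enclose an angle of at most ninety degrees,
then, having length at least one, they satisfy
\<open>(norm ((1 - t) *\<^sub>R u + t *\<^sub>R v))\<^sup>2 \<ge> (1 - t)\<^sup>2 + t\<^sup>2 \<ge> 1 / 2\<close>. So \<open>l\<close> has distance at least \<open>sqrt 2 / 2\<close> from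
the segment between the other nodes, which is more than two radii \<open>r < sqrt 2 / 4\<close>.\<close>

lemma not_between_acute:
  assumes small: "small_obstacle B" and acute: "0 \<le> lattice_vec (i - l) \<bullet> lattice_vec (j - l)"
  shows "\<not> between B l i j"
proof
  assume "between B l i j"
  then have l: "l \<noteq> i" "l \<noteq> j"
    and "obstacle B l \<inter> convex hull (obstacle B i \<union> obstacle B j) \<noteq> {}"
    unfolding between_def by auto
  then obtain x where x: "x \<in> obstacle B l" "x \<in> convex hull (obstacle B i \<union> obstacle B j)"
    by blast
  obtain r where r: "r < sqrt 2 / 4" "B \<subseteq> cball 0 r"
    using small unfolding small_obstacle_def by blast
  \<comment> \<open>The \<open>r\<close>-neighbourhood of the segment between the nodes is convex and contains both obstacles.\<close>
  let ?S = "closed_segment (lattice_vec i) (lattice_vec j)"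
  let ?N = "\<Union>p\<in>?S. \<Union>e\<in>cball 0 r. {p + e}"
  have near: "e + p \<in> ?N" if "e \<in> B" "p \<in> ?S" for e p
    using that r by (intro UN_I[of p] UN_I[of e]) (auto simp: add.commute)
  have "obstacle B k \<subseteq> ?N" if "lattice_vec k \<in> ?S" for k
    unfolding obstacle_def by (rule image_subsetI) (rule near[OF _ that])
  then have "obstacle B i \<union> obstacle B j \<subseteq> ?N"
    by (intro Un_least) simp_all
  moreover have "convex ?N"
    by (intro convex_sums) auto
  ultimately have "x \<in> ?N"
    using x hull_minimal[of "obstacle B i \<union> obstacle B j" ?N convex] by blast
  then obtain p e where p: "p \<in> ?S" "e \<in> cball 0 r" "x = p + e"
    by blast
  then have e: "norm e \<le> r"
    by simp
  obtain b where b: "norm b \<le> r" "x = b + lattice_vec l"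
    using x r unfolding obstacle_def by (auto simp: subset_iff)
  obtain t where t: "0 \<le> t" "t \<le> 1" "p = (1 - t) *\<^sub>R lattice_vec i + t *\<^sub>R lattice_vec j"
    using p unfolding in_segment by blast
  define u where "u = lattice_vec (i - l)"
  define v where "v = lattice_vec (j - l)"
  have uv: "1 \<le> u \<bullet> u" "1 \<le> v \<bullet> v" "0 \<le> u \<bullet> v"
    using l acute lattice_vec_inner_self_ge_1[of "i - l"] lattice_vec_inner_self_ge_1[of "j - l"]
    unfolding u_def v_def by auto
  have "(b - e) - (p - lattice_vec l) = (b + lattice_vec l) - (p + e)"
    by (simp add: algebra_simps)
  also have "\<dots> = 0"
    unfolding b(2)[symmetric] p(3)[symmetric] by (rule diff_self)
  finally have "b - e = p - lattice_vec l"
    by (rule right_minus_eq[THEN iffD1])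
  then have be: "b - e = (1 - t) *\<^sub>R u + t *\<^sub>R v"
    unfolding t(3) u_def v_def by (simp add: algebra_simps)
  have "(b - e) \<bullet> (b - e) = (1 - t)\<^sup>2 * (u \<bullet> u) + t\<^sup>2 * (v \<bullet> v) + 2 * (t * (1 - t)) * (u \<bullet> v)"
    unfolding be
    by (simp add: inner_add_left inner_add_right inner_commute[of v u] algebra_simps power2_eq_square)
  moreover have "(1 - t)\<^sup>2 * 1 \<le> (1 - t)\<^sup>2 * (u \<bullet> u)" "t\<^sup>2 * 1 \<le> t\<^sup>2 * (v \<bullet> v)"
    using uv by (intro mult_left_mono; simp)+
  moreover have "0 \<le> 2 * (t * (1 - t)) * (u \<bullet> v)"
    using uv t by simp
  moreover have "1 / 2 \<le> (1 - t)\<^sup>2 + t\<^sup>2"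
    using zero_le_power2[of "2 * t - 1"] by (simp add: power2_eq_square algebra_simps)
  ultimately have "1 / 2 \<le> (norm (b - e))\<^sup>2"
    by (simp add: power2_norm_eq_inner)
  moreover have "norm (b - e) < sqrt 2 / 2"
    using b(1) e r(1) norm_triangle_ineq4[of b e] by simp
  then have "(norm (b - e))\<^sup>2 < (sqrt 2 / 2)\<^sup>2"
    by (intro power_strict_mono) auto
  ultimately show False
    by (simp add: power_divide)
qed

lemma between_translate:
  fixes B :: "(real ^ 'm) set"
  shows "between B (l + c) (i + c) (j + c) \<longleftrightarrow> between B l i j"
proof -
  have shift: "obstacle B (k + c) = (+) (lattice_vec c) ` obstacle B k" for k
    unfolding obstacle_def image_image by (simp add: add_ac)
  have "(+) v ` X \<inter> (+) v ` Y \<noteq> {} \<longleftrightarrow> X \<inter> Y \<noteq> {}" for v :: "real ^ 'm" and X Y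
    by (simp add: image_Int[OF inj_on_add, symmetric])
  then show ?thesis
    unfolding between_def shift image_Un[symmetric] convex_hull_translation by simp
qed

definition unit_step :: "int ^ 'm \<Rightarrow> bool" where
  "unit_step c \<longleftrightarrow> (\<exists>p. c = axis p 1 \<or> c = axis p (- 1))"

lemma unit_step_nonzero: "unit_step c \<Longrightarrow> c \<noteq> 0"
  unfolding unit_step_def by auto

text \<open>The angle at \<open>l\<close> is not obtuse: \<open>x * (x + 1)\<close> and \<open>x * (x - 1)\<close> are nonnegative for every integer \<open>x\<close>.\<close>

lemma not_between_unit_step:
  assumes "small_obstacle B" "unit_step c"
  shows "\<not> between B l i (i + c)"
proof (rule not_between_acute[OF assms(1)])
  define d where "d = i - l"
  obtain p where p: "c = axis p 1 \<or> c = axis p (- 1)"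
    using assms unfolding unit_step_def by blast
  have square: "0 \<le> x * (x + 1)" "0 \<le> x * (x - 1)" for x :: int
    by (cases "x \<ge> 0"; cases "x \<ge> 1"; simp add: zero_le_mult_iff)+
  have "0 \<le> d $ j * (d + c) $ j" for j
    using p square[of "d $ j"] by (auto simp: axis_def)
  then have "0 \<le> (\<Sum>j\<in>UNIV. d $ j * (d + c) $ j)"
    by (intro sum_nonneg) auto
  then have "0 \<le> lattice_vec d \<bullet> lattice_vec (d + c)"
    unfolding lattice_vec_inner by (simp del: of_int_sum)
  then show "0 \<le> lattice_vec (i - l) \<bullet> lattice_vec (i + c - l)"
    unfolding d_def by (simp add: algebra_simps)
qed

definition link ::
    "nat \<Rightarrow> (nat \<Rightarrow> int ^ 'm) \<Rightarrow> int ^ 'm \<Rightarrow> int ^ 'm \<Rightarrow> (nat \<Rightarrow> int ^ 'm) \<Rightarrow> nat \<Rightarrow> int ^ 'm" where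
  "link s k c c' k' i =
     (if i \<le> s then k i else if i = s + 1 then k s + c else k s + c + c' + k' (i - (s + 2)))"

lemma link_simps:
  "i \<le> s \<Longrightarrow> link s k c c' k' i = k i"
  "link s k c c' k' (s + 1) = k s + c"
  "link s k c c' k' (s + 2 + j) = k' j + (k s + c + c')"
  by (simp_all add: link_def algebra_simps)

text \<open>Inside \<open>k\<close> and \<open>k'\<close> the conditions are inherited, by translation invariance. A unit step has no
obstacle in between, and at each of the three new corners the path turns by at least ninety degrees,
so the angle seen from the middle node is not obtuse.\<close>

lemma admissible_link:
  assumes small: "small_obstacle B"
    and k: "admissible B s k" and k': "admissible B s' k'"
    and c: "unit_step c" and c': "unit_step c'"
    and turn: "s \<ge> 1 \<Longrightarrow> lattice_vec (k s - k (s - 1)) \<bullet> lattice_vec c \<le> 0"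
    and turn_mid: "lattice_vec c \<bullet> lattice_vec c' \<le> 0"
    and turn': "s' \<ge> 1 \<Longrightarrow> lattice_vec c' \<bullet> lattice_vec (k' 1) \<le> 0"
  shows "admissible B (s + 2 + s') (link s k c c' k')"
proof -
  let ?K = "link s k c c' k'"
  have k'0: "k' 0 = 0"
    using k' unfolding admissible_def by blast
  have K: "?K n = k n" if "n \<le> s" for n
    by (rule link_simps(1)[OF that])
  have K1: "?K (Suc s) = k s + c"
    using link_simps(2)[of s k c c' k'] by simp
  have K2: "?K (Suc (Suc (s + j))) = k' j + (k s + c + c')" for j
    using link_simps(3)[of s k c c' k' j] by simp
  have K20: "?K (Suc (Suc s)) = k s + c + c'"
    using K2[of 0] k'0 by simp
  have edge: "?K (Suc n) \<noteq> ?K n \<and> \<not> (\<exists>l. between B l (?K n) (?K (Suc n)))"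
    if n: "Suc n \<le> s + 2 + s'" for n
  proof -
    consider "Suc n \<le> s" | "n = s" | "n = Suc s" | "Suc (Suc s) \<le> n"
      by linarith
    then show ?thesis
    proof cases
      case 1
      then show ?thesis
        using k unfolding admissible_def by (simp add: K)
    next
      case 2
      then show ?thesis
        using not_between_unit_step[OF small c] unit_step_nonzero[OF c] by (simp add: K K1)
    next
      case 3
      then show ?thesis
        using not_between_unit_step[OF small c'] unit_step_nonzero[OF c']
        by (simp add: K1 K20)
    next
      case 4
      define j where "j = n - Suc (Suc s)"
      have j: "n = Suc (Suc (s + j))"
        using 4 unfolding j_def by simp
      then have j': "Suc j \<le> s'"
        using n by simp
      have "?K n = k' j + (k s + c + c')" "?K (Suc n) = k' (Suc j) + (k s + c + c')"
        using K2[of j] K2[of "Suc j"] unfolding j by simp_all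
      moreover have "\<not> between B l (k' j + a) (k' (Suc j) + a)" for l a
        using k' j' between_translate[of B "l - a" a] unfolding admissible_def by simp
      moreover have "k' (Suc j) \<noteq> k' j"
        using k' j' unfolding admissible_def by simp
      ultimately show ?thesis
        by simp
    qed
  qed
  have vertex: "\<not> between B (?K (Suc n)) (?K n) (?K (Suc (Suc n)))"
    if n: "Suc (Suc n) \<le> s + 2 + s'" for n
  proof -
    consider "Suc (Suc n) \<le> s" | "Suc n = s" | "n = s" | "n = Suc s" | "Suc (Suc s) \<le> n"
      by linarith
    then show ?thesis
    proof cases
      case 1
      then show ?thesis
        using k unfolding admissible_def by (simp add: K)
    next
      case 2
      have "\<not> between B (k s) (k n) (k s + c)"
        using turn 2 by (intro not_between_acute small) (auto simp: inner_diff_left)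
      then show ?thesis
        using K[of s] K[of n] K1 2 by auto
    next
      case 3
      have "\<not> between B (k s + c) (k s) (k s + c + c')"
        using turn_mid by (intro not_between_acute small) auto
      then show ?thesis
        using K[of s] K1 K20 3 by simp
    next
      case 4
      have "\<not> between B (k s + c + c') (k s + c) (k' 1 + (k s + c + c'))"
        using turn' n 4 by (intro not_between_acute small) auto
      then show ?thesis
        using K1 K20 K2[of 1] 4 by simp
    next
      case 5
      define j where "j = n - Suc (Suc s)"
      have j: "n = Suc (Suc (s + j))"
        using 5 unfolding j_def by simp
      then have j': "Suc (Suc j) \<le> s'"
        using n by simp
      have "?K n = k' j + (k s + c + c')" "?K (Suc n) = k' (Suc j) + (k s + c + c')"
        "?K (Suc (Suc n)) = k' (Suc (Suc j)) + (k s + c + c')"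
        using K2[of j] K2[of "Suc j"] K2[of "Suc (Suc j)"] unfolding j by simp_all
      then show ?thesis
        using k' j' unfolding admissible_def by (simp add: between_translate)
    qed
  qed
  have start: "?K 0 = 0"
    using K[of 0] k unfolding admissible_def by simp
  show ?thesis
    using edge vertex start unfolding admissible_def by simp
qed

lemma unit_step_turning:
  fixes a :: "int ^ 'm"
  obtains c where "c = axis p 1 \<or> c = axis p (- 1)" "lattice_vec a \<bullet> lattice_vec c \<le> 0"
proof -
  have "lattice_vec a \<bullet> lattice_vec (axis p x) = of_int (a $ p * x)" for x
  proof -
    have "(\<Sum>i\<in>UNIV. a $ i * axis p x $ i) = (\<Sum>i\<in>UNIV. if i = p then a $ p * x else 0)"
      by (intro sum.cong) (auto simp: axis_def)
    then show ?thesis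
      unfolding lattice_vec_inner by (simp del: of_int_sum)
  qed
  then show ?thesis
    using that[of "axis p 1"] that[of "axis p (- 1)"] by (cases "a $ p \<le> 0") auto
qed

text \<open>Take \<open>c\<close> along one coordinate axis and \<open>c'\<close> along a different one. They are orthogonal, and
their signs can be chosen independently so as to turn away from \<open>a\<close> and from \<open>b\<close>.\<close>

lemma exists_linking_steps:
  fixes a b :: "int ^ 'm"
  assumes "CARD('m) \<ge> 2"
  obtains c c' where "unit_step c" "unit_step c'" "lattice_vec a \<bullet> lattice_vec c \<le> 0"
    "lattice_vec c \<bullet> lattice_vec c' \<le> 0" "lattice_vec c' \<bullet> lattice_vec b \<le> 0"
proof -
  have "\<not> CARD('m) \<le> Suc 0"
    using assms by simp
  then have "\<exists>p q :: 'm. p \<noteq> q"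
    using card_le_Suc0_iff_eq[of "UNIV :: 'm set"] by auto
  then obtain p q :: 'm where pq: "p \<noteq> q"
    by blast
  obtain c where c: "c = axis p 1 \<or> c = axis p (- 1)" "lattice_vec a \<bullet> lattice_vec c \<le> 0"
    by (rule unit_step_turning[of p a])
  obtain c' where c': "c' = axis q 1 \<or> c' = axis q (- 1)" "lattice_vec b \<bullet> lattice_vec c' \<le> 0"
    by (rule unit_step_turning[of q b])
  have "(\<Sum>i\<in>UNIV. c $ i * c' $ i) = 0"
    using c(1) c'(1) pq by (intro sum.neutral) (auto simp: axis_def)
  then have "lattice_vec c \<bullet> lattice_vec c' = 0"
    unfolding lattice_vec_inner by simp
  moreover have "unit_step c" "unit_step c'"
    using c c' unfolding unit_step_def by auto
  ultimately show ?thesis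
    using that[of c c'] c(2) c'(2) by (simp add: inner_commute)
qed


section \<open>Obstacles and trajectories\<close>

lemma obstacle_translate: "obstacle B (k + q) = (\<lambda>x. x + lattice_vec q) ` obstacle B k"
  unfolding obstacle_def image_image by (simp add: add_ac)

lemma obstacle_geometry:
  assumes "billiard_obstacle B"
  shows "compact (obstacle B k)" "convex (obstacle B k)" "interior (obstacle B k) \<noteq> {}"
    "smooth_hypersurface (frontier (obstacle B k))" "obstacle B k \<noteq> {}"
proof -
  have B: "compact B" "convex B" "interior B \<noteq> {}" "smooth_hypersurface (frontier B)"
    using assms unfolding billiard_obstacle_def strictly_convex_def by auto
  have eq: "obstacle B k = (+) (lattice_vec k) ` B"
    unfolding obstacle_def by (simp add: add.commute)
  show "compact (obstacle B k)" "convex (obstacle B k)"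
    unfolding eq using B compact_translation convex_translation by blast+
  show int: "interior (obstacle B k) \<noteq> {}"
    unfolding eq interior_translation using B by simp
  show "smooth_hypersurface (frontier (obstacle B k))"
    unfolding eq frontier_translation using B smooth_hypersurface_translate by blast
  show "obstacle B k \<noteq> {}"
    using int by auto
qed

lemma obstacles_disjoint:
  "billiard_obstacle B \<Longrightarrow> k \<noteq> l \<Longrightarrow> x \<in> obstacle B k \<Longrightarrow> y \<in> obstacle B l \<Longrightarrow> x \<noteq> y"
  unfolding billiard_obstacle_def by blast

lemma dist_obstacle_le:
  assumes "small_obstacle B" and x: "x \<in> obstacle B k" and y: "y \<in> obstacle B l"
  shows "norm ((y - x) - (lattice_vec l - lattice_vec k)) \<le> 1"
proof -
  obtain r where r: "r < sqrt 2 / 4" "B \<subseteq> cball 0 r"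
    using assms unfolding small_obstacle_def by blast
  obtain a b where ab: "a \<in> B" "b \<in> B" "x = a + lattice_vec k" "y = b + lattice_vec l"
    using x y unfolding obstacle_def by blast
  then have "norm a \<le> r" "norm b \<le> r"
    using r by auto
  moreover have "sqrt 2 \<le> 2"
    by (rule real_le_lsqrt) auto
  ultimately have "norm (b - a) \<le> 1"
    using r norm_triangle_ineq4[of b a] by linarith
  then show ?thesis
    unfolding ab by (simp add: algebra_simps)
qed

lemma collinear_if_same_direction:
  fixes a b c :: "'a::real_normed_vector"
  assumes same: "sgn (b - a) = sgn (c - b)" and "a \<noteq> b"
  shows "b \<in> closed_segment a c"
proof -
  define u where "u = norm (b - a)"
  define v where "v = norm (c - b)"
  have u: "u > 0" "v \<ge> 0"
    using assms unfolding u_def v_def by auto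
  define d where "d = sgn (b - a)"
  have norm_sgn_eq: "x = norm x *\<^sub>R sgn x" for x :: 'a
    by (cases "x = 0") (simp_all add: sgn_div_norm)
  have "b - a = u *\<^sub>R d"
    unfolding u_def d_def by (rule norm_sgn_eq)
  moreover have "c - b = v *\<^sub>R d"
    unfolding v_def d_def same by (rule norm_sgn_eq)
  ultimately have a: "a = b - u *\<^sub>R d" and c: "c = b + v *\<^sub>R d"
    by (simp_all add: algebra_simps)
  have "(1 - u / (u + v)) *\<^sub>R a + (u / (u + v)) *\<^sub>R c
      = b + ((u / (u + v)) * v - (1 - u / (u + v)) * u) *\<^sub>R d"
    unfolding a c by (simp add: algebra_simps)
  also have "(u / (u + v)) * v - (1 - u / (u + v)) * u = 0"
    using u by (simp add: field_simps)
  finally show ?thesis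
    unfolding in_segment using u by (intro exI[of _ "u / (u + v)"]) auto
qed

text \<open>Without a kink an inner vertex would lie on the segment between its neighbours, and its obstacle
would be between theirs, against the last condition of admissibility.\<close>

lemma shortest_path_kink_nonzero:
  fixes B :: "(real ^ 'm) set"
  assumes k: "admissible B s k" and s: "s \<ge> 1" and short: "shortest_path s (\<lambda>i. obstacle B (k i)) z"
    and distinct: "\<And>i. i < s \<Longrightarrow> z i \<noteq> z (i + 1)" and i: "i \<le> s"
  shows "kink s z i \<noteq> 0"
proof -
  consider "i = 0" | "i = s" | n where "i = Suc n" "Suc n < s"
    using i by (cases i) fastforce+
  then show ?thesis
  proof cases
    case 1
    then show ?thesis
      using distinct[of 0] s unfolding kink_def by (simp add: sgn_zero_iff)
  next
    case 2
    then show ?thesis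
      using distinct[of "s - 1"] s unfolding kink_def by (simp add: sgn_zero_iff)
  next
    case (3 n)
    show ?thesis
    proof
      assume "kink s z i = 0"
      then have "sgn (z (Suc n) - z n) = sgn (z (Suc (Suc n)) - z (Suc n))"
        using 3 unfolding kink_def by simp
      then have "z (Suc n) \<in> closed_segment (z n) (z (Suc (Suc n)))"
        using distinct[of n] 3 by (intro collinear_if_same_direction) auto
      moreover have "z j \<in> obstacle B (k j)" if "j \<le> s" for j
        using short that unfolding shortest_path_def by blast
      then have "z n \<in> obstacle B (k n)" "z (Suc (Suc n)) \<in> obstacle B (k (Suc (Suc n)))"
        and zi: "z (Suc n) \<in> obstacle B (k (Suc n))"
        using 3 by simp_all
      then have "closed_segment (z n) (z (Suc (Suc n)))
          \<subseteq> convex hull (obstacle B (k n) \<union> obstacle B (k (Suc (Suc n))))"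
        by (intro closed_segment_subset_convex_hull hull_inc) auto
      moreover have "k (Suc n) \<noteq> k n" "k (Suc (Suc n)) \<noteq> k (Suc n)"
        "\<not> between B (k (Suc n)) (k n) (k (Suc (Suc n)))"
        using k 3 unfolding admissible_def by simp_all
      ultimately show False
        using zi unfolding between_def by (metis IntI empty_iff subsetD)
    qed
  qed
qed

text \<open>Every kink of a shortest path of admissible type is nonzero, so all vertices lie on the boundary
and optimality gives the reflection law. An edge stays out of the interiors of the two obstacles
that it joins because it cannot meet them twice, and of all others because none is between these two.\<close>

lemma shortest_path_is_trajectory:
  fixes B :: "(real ^ 'm) set"
  assumes B: "billiard_obstacle B" and k: "admissible B s k" and s: "s \<ge> 1"
    and short: "shortest_path s (\<lambda>i. obstacle B (k i)) z"
  shows "trajectory_of_type B s k z"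
proof -
  note geometry = obstacle_geometry[OF B]
  have zO: "z i \<in> obstacle B (k i)" if "i \<le> s" for i
    using short that unfolding shortest_path_def by blast
  have distinct: "z i \<noteq> z (i + 1)" if i: "i < s" for i
  proof (rule obstacles_disjoint[OF B])
    show "k i \<noteq> k (i + 1)"
      using k i unfolding admissible_def by (metis Suc_eq_plus1 Suc_leI)
  qed (use zO i in auto)
  have kinks: "kink s z i \<noteq> 0" if "i \<le> s" for i
    using shortest_path_kink_nonzero[OF k s short distinct that] .
  have outside: "z i \<notin> interior (obstacle B (k i))" if "i \<le> s" for i
    using shortest_path_not_interior[OF short geometry(2) distinct that kinks[OF that]] .
  have boundary: "z i \<in> frontier (obstacle B (k i))" if "i \<le> s" for i
    using outside zO that closure_subset unfolding frontier_def by blast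
  have free: "closed_segment (z i) (z (i + 1)) \<inter> interior (obstacle B l) = {}" if i: "i < s" for i l
  proof (rule ccontr)
    assume "\<not> ?thesis"
    then obtain x where x: "x \<in> closed_segment (z i) (z (i + 1))" "x \<in> interior (obstacle B l)"
      by blast
    then have xl: "x \<in> obstacle B l"
      using interior_subset by blast
    have "closed_segment (z i) (z (i + 1)) \<subseteq> convex hull (obstacle B (k i) \<union> obstacle B (k (i + 1)))"
      using zO[of i] zO[of "i + 1"] i by (intro closed_segment_subset_convex_hull hull_inc) auto
    moreover have "\<not> between B l (k i) (k (i + 1))"
      using k i unfolding admissible_def by auto
    ultimately consider "l = k i" | "l = k (i + 1)"
      using x xl unfolding between_def by blast
    then show False
    proof cases
      case 1
      then have "x = z i"
        using shortest_path_edge(1)[OF short geometry(2) geometry(2) distinct i kinks kinks x(1)] i xl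
        by simp
      then show ?thesis
        using x outside[of i] i 1 by simp
    next
      case 2
      then have "x = z (i + 1)"
        using shortest_path_edge(2)[OF short geometry(2) geometry(2) distinct i kinks kinks x(1)] i xl
        by simp
      then show ?thesis
        using x outside[of "i + 1"] i 2 by simp
    qed
  qed
  have "reflects (frontier (obstacle B (k i))) (z i) (sgn (z i - z (i - 1))) (sgn (z (i + 1) - z i))"
    if i: "0 < i" "i < s" for i
  proof -
    have kink_eq: "kink s z i = sgn (z i - z (i - 1)) - sgn (z (i + 1) - z i)"
      using i unfolding kink_def by simp
    obtain n where n: "unit_normal (frontier (obstacle B (k i))) (z i) n"
      using unit_normal_exists[OF geometry(4) boundary[of i]] i by auto
    have "norm (sgn (z i - z (i - 1))) = 1" "norm (sgn (z (i + 1) - z i)) = 1"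
      using distinct[of i] distinct[of "i - 1"] i by (simp_all add: norm_sgn less_imp_diff_less)
    moreover have "sgn (z i - z (i - 1)) \<noteq> sgn (z (i + 1) - z i)"
      using kinks[of i] i unfolding kink_eq by simp
    moreover have "0 \<le> (sgn (z i - z (i - 1)) - sgn (z (i + 1) - z i)) \<bullet> (y - z i)"
      if "y \<in> obstacle B (k i)" for y
      using shortest_path_kink[OF short geometry(2) distinct _ that] i unfolding kink_eq by simp
    ultimately show ?thesis
      using reflection_of_minimality[OF geometry(2,3) n] n unfolding reflects_def by blast
  qed
  then show ?thesis
    unfolding trajectory_of_type_def using boundary free by (intro exI[of _ 0]) auto
qed

lemma admissible_type_realised:
  assumes "billiard_obstacle B" "admissible B s k" "s \<ge> 1"
  shows "\<exists>z. trajectory_of_type B s k z"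
  using shortest_path_exists[of "\<lambda>i. obstacle B (k i)" s] obstacle_geometry[OF assms(1)]
    shortest_path_is_trajectory[OF assms] by blast

text \<open>The reflection law makes the linearised length nonnegative at all inner vertices. Only the two end
points contribute negatively, each by at most the diameter of the obstacle, which is at most \<open>1\<close>.
Hence the length of a trajectory piece is determined by its type up to the constant \<open>2\<close>.\<close>

lemma trajectory_nearly_shortest:
  fixes B :: "(real ^ 'm) set"
  assumes B: "billiard_obstacle B" and small: "small_obstacle B"
    and z: "trajectory_of_type B s k z" and y: "\<And>i. i \<le> s \<Longrightarrow> y i \<in> obstacle B (k i)"
  shows "path_length s z \<le> path_length s y + 2"
proof -
  note geometry = obstacle_geometry[OF B]
  obtain q where boundary: "\<forall>i\<le>s. z i \<in> frontier (obstacle B (k i + q))"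
    and free: "\<forall>i<s. \<forall>l. closed_segment (z i) (z (i + 1)) \<inter> interior (obstacle B l) = {}"
    and reflects: "\<forall>i. 0 < i \<and> i < s \<longrightarrow> reflects (frontier (obstacle B (k i + q))) (z i)
        (sgn (z i - z (i - 1))) (sgn (z (i + 1) - z i))"
    using z unfolding trajectory_of_type_def by (elim exE conjE) (rule that)
  define y' where "y' i = y i + lattice_vec q" for i
  have y': "y' i \<in> obstacle B (k i + q)" if "i \<le> s" for i
    using y[OF that] unfolding y'_def obstacle_translate by blast
  have zO: "z i \<in> obstacle B (k i + q)" if "i \<le> s" for i
    using boundary that frontier_subset_compact[OF geometry(1)] by blast
  have close: "norm (y' i - z i) \<le> 1" if "i \<le> s" for i
    using dist_obstacle_le[OF small zO y'] that by fastforce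
  have vertex: "(if i = 0 then - 1 else 0) + (if i = s then - 1 else 0) \<le> kink s z i \<bullet> (y' i - z i)"
    if i: "i \<le> s" for i
  proof (cases "0 < i \<and> i < s")
    case True
    then have kink_eq: "kink s z i = sgn (z i - z (i - 1)) - sgn (z (i + 1) - z i)"
      unfolding kink_def by simp
    obtain n where n: "unit_normal (frontier (obstacle B (k i + q))) (z i) n"
      "sgn (z (i + 1) - z i) = sgn (z i - z (i - 1)) - (2 * (sgn (z i - z (i - 1)) \<bullet> n)) *\<^sub>R n"
      using reflects True unfolding reflects_def by blast
    have "closed_segment (z (i - 1)) (z i) \<inter> interior (obstacle B (k i + q)) = {}"
      using free[rule_format, of "i - 1" "k i + q"] True by (simp add: less_imp_diff_less)
    then have "0 \<le> kink s z i \<bullet> (y' i - z i)"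
      unfolding kink_eq
      using minimality_of_reflection[OF geometry(2,3) n(1) _ refl n(2) y'[OF i]] by blast
    then show ?thesis
      using True by simp
  next
    case False
    have "\<bar>kink s z i \<bullet> (y' i - z i)\<bar> \<le> norm (kink s z i) * norm (y' i - z i)"
      by (rule Cauchy_Schwarz_ineq2)
    also have "\<dots> \<le> norm (kink s z i)"
      using close[OF i] by (intro mult_left_le) auto
    also have "\<dots> \<le> (if i = 0 then 1 else 0) + (if i = s then 1 else 0)"
      using False i unfolding kink_def by (auto simp: norm_sgn)
    finally show ?thesis
      by (auto split: if_splits)
  qed
  have "(\<Sum>i\<le>s. (if i = 0 then - 1 else 0) + (if i = s then - 1 else 0)) \<le> (\<Sum>i\<le>s. kink s z i \<bullet> (y' i - z i))"
    using vertex by (intro sum_mono) auto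
  then have "- 2 \<le> (\<Sum>i\<le>s. kink s z i \<bullet> (y' i - z i))"
    by (simp add: sum.distrib)
  moreover have "path_length s y' = path_length s y"
    unfolding path_length_def y'_def by simp
  ultimately show ?thesis
    using path_length_above_tangent[of s z y'] by simp
qed

section \<open>Limit directions of approximately additive sets\<close>

definition approximately_additive ::
    "real \<Rightarrow> ('a::real_normed_vector \<Rightarrow> real \<Rightarrow> bool) \<Rightarrow> bool" where
  "approximately_additive K P \<longleftrightarrow>
     (\<forall>d t d' t'. P d t \<longrightarrow> P d' t' \<longrightarrow>
        (\<exists>D T. P D T \<and> norm (D - (d + d')) \<le> K \<and> \<bar>T - (t + t')\<bar> \<le> K))"

definition limit_directions :: "('a::real_normed_vector \<Rightarrow> real \<Rightarrow> bool) \<Rightarrow> 'a set" where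
  "limit_directions P = {w. \<exists>d t. (\<forall>n. P (d n) (t n)) \<and> filterlim t at_top sequentially \<and>
     (\<lambda>n. d n /\<^sub>R t n) \<longlonglongrightarrow> w}"

text \<open>This form lets the convexity proof work with single pairs instead of sequences.\<close>

lemma limit_directions_iff:
  "w \<in> limit_directions P \<longleftrightarrow>
     (\<forall>\<epsilon>>0. \<forall>T. \<exists>d t. P d t \<and> T \<le> t \<and> norm (d - t *\<^sub>R w) \<le> \<epsilon> * t)"
proof (intro iffI allI impI)
  fix \<epsilon> T :: real
  assume "w \<in> limit_directions P" and \<epsilon>: "\<epsilon> > 0"
  then obtain d t where P: "\<And>n. P (d n) (t n)" and t: "filterlim t at_top sequentially"
    and lim: "(\<lambda>n. d n /\<^sub>R t n) \<longlonglongrightarrow> w"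
    unfolding limit_directions_def by blast
  have "\<forall>\<^sub>F n in sequentially. max T 1 \<le> t n \<and> dist (d n /\<^sub>R t n) w < \<epsilon>"
    using t lim \<epsilon> unfolding filterlim_at_top by (intro eventually_conj tendstoD) blast+
  then obtain n where n: "max T 1 \<le> t n" "dist (d n /\<^sub>R t n) w < \<epsilon>"
    by (auto simp: eventually_sequentially)
  have "d n - t n *\<^sub>R w = t n *\<^sub>R (d n /\<^sub>R t n - w)"
    using n by (simp add: algebra_simps)
  then have "norm (d n - t n *\<^sub>R w) = t n * dist (d n /\<^sub>R t n) w"
    using n by (simp add: dist_norm)
  also have "\<dots> \<le> \<epsilon> * t n"
    using n by (simp add: mult.commute)
  finally show "\<exists>d t. P d t \<and> T \<le> t \<and> norm (d - t *\<^sub>R w) \<le> \<epsilon> * t"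
    using P n by auto
next
  assume *: "\<forall>\<epsilon>>0. \<forall>T. \<exists>d t. P d t \<and> T \<le> t \<and> norm (d - t *\<^sub>R w) \<le> \<epsilon> * t"
  have "\<exists>d t. P d t \<and> real (Suc n) \<le> t \<and> norm (d - t *\<^sub>R w) \<le> inverse (real (Suc n)) * t" for n
    using * by simp
  then obtain d t where P: "\<And>n. P (d n) (t n)" and t: "\<And>n. real (Suc n) \<le> t n"
    and close: "\<And>n. norm (d n - t n *\<^sub>R w) \<le> inverse (real (Suc n)) * t n"
    by metis
  have "filterlim t at_top sequentially"
    using filterlim_at_top_mono[OF filterlim_real_sequentially, of t] t
    by (smt (verit, best) always_eventually of_nat_Suc)
  moreover have "norm (d n /\<^sub>R t n - w) \<le> inverse (real (Suc n))" for n
  proof -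
    have pos: "t n > 0"
      using t[of n] by simp
    then have "d n /\<^sub>R t n - w = (d n - t n *\<^sub>R w) /\<^sub>R t n"
      by (simp add: algebra_simps)
    then have "norm (d n /\<^sub>R t n - w) = norm (d n - t n *\<^sub>R w) / t n"
      using pos by (simp add: divide_inverse mult.commute)
    also have "\<dots> \<le> inverse (real (Suc n))"
      using close[of n] pos by (simp add: pos_divide_le_eq)
    finally show ?thesis .
  qed
  then have "\<forall>n. norm (d n /\<^sub>R t n - w) \<le> inverse (real (Suc n))"
    by blast
  then have "(\<lambda>n. d n /\<^sub>R t n) \<longlonglongrightarrow> w"
    by (rule LIM_zero_cancel[OF Lim_null_comparison[OF always_eventually LIMSEQ_inverse_real_of_nat]])
  ultimately show "w \<in> limit_directions P"
    using P unfolding limit_directions_def by blast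
qed

lemma approximately_additive_multiples:
  assumes add: "approximately_additive K P" and K: "0 \<le> K" and "P d t" "P d' t'"
  shows "\<exists>D T. P D T \<and>
     norm (D - (real (Suc p) *\<^sub>R d + real (Suc q) *\<^sub>R d')) \<le> (real p + real q + 1) * K \<and>
     \<bar>T - (real (Suc p) * t + real (Suc q) * t')\<bar> \<le> (real p + real q + 1) * K"
proof (induction q)
  case 0
  show ?case
  proof (induction p)
    case 0
    then show ?case
      using add assms(3,4) unfolding approximately_additive_def by simp
  next
    case (Suc p)
    then obtain D T where DT: "P D T"
      "norm (D - (real (Suc p) *\<^sub>R d + d')) \<le> (real p + 1) * K"
      "\<bar>T - (real (Suc p) * t + t')\<bar> \<le> (real p + 1) * K"
      by (auto simp: add.commute)
    obtain D' T' where DT': "P D' T'" "norm (D' - (D + d)) \<le> K" "\<bar>T' - (T + t)\<bar> \<le> K"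
      using add DT(1) assms(3) unfolding approximately_additive_def by blast
    have "D' - (real (Suc (Suc p)) *\<^sub>R d + d') = (D' - (D + d)) + (D - (real (Suc p) *\<^sub>R d + d'))"
      by (simp add: algebra_simps scaleR_2)
    then have "norm (D' - (real (Suc (Suc p)) *\<^sub>R d + d')) \<le> K + (real p + 1) * K"
      using DT DT' by (metis add_mono norm_triangle_le)
    moreover have "\<bar>T' - (real (Suc (Suc p)) * t + t')\<bar> \<le> K + (real p + 1) * K"
      using DT DT' by (simp add: algebra_simps)
    ultimately show ?case
      using DT'(1) by (intro exI[of _ D'] exI[of _ T']) (simp add: algebra_simps)
  qed
next
  case (Suc q)
  then obtain D T where DT: "P D T"
    "norm (D - (real (Suc p) *\<^sub>R d + real (Suc q) *\<^sub>R d')) \<le> (real p + real q + 1) * K"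
    "\<bar>T - (real (Suc p) * t + real (Suc q) * t')\<bar> \<le> (real p + real q + 1) * K"
    by auto
  obtain D' T' where DT': "P D' T'" "norm (D' - (D + d')) \<le> K" "\<bar>T' - (T + t')\<bar> \<le> K"
    using add DT(1) assms(4) unfolding approximately_additive_def by blast
  have "D' - (real (Suc p) *\<^sub>R d + real (Suc (Suc q)) *\<^sub>R d')
      = (D' - (D + d')) + (D - (real (Suc p) *\<^sub>R d + real (Suc q) *\<^sub>R d'))"
    by (simp add: algebra_simps scaleR_2)
  then have "norm (D' - (real (Suc p) *\<^sub>R d + real (Suc (Suc q)) *\<^sub>R d')) \<le> K + (real p + real q + 1) * K"
    using DT DT' by (metis add_mono norm_triangle_le)
  moreover have "\<bar>T' - (real (Suc p) * t + real (Suc (Suc q)) * t')\<bar> \<le> K + (real p + real q + 1) * K"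
    using DT DT' by (simp add: algebra_simps)
  ultimately show ?case
    using DT'(1) by (intro exI[of _ D'] exI[of _ T']) (simp add: algebra_simps)
qed

text \<open>Given pairs \<open>(d, t)\<close> and \<open>(d', t')\<close> with directions close to \<open>u\<close> and \<open>v\<close>, adding up suitably many
copies of each gives total lengths \<open>a\<close> and \<open>b\<close> in nearly the ratio of \<open>l\<close> to \<open>l'\<close>. Each
summand costs an error of at most \<open>K\<close>, which is negligible when \<open>t\<close> and \<open>t'\<close> are large compared to \<open>K\<close>.\<close>

lemma convex_limit_directions:
  assumes add: "approximately_additive K P" and K: "0 \<le> K"
  shows "convex (limit_directions P)"
proof (rule convexI)
  fix u v and l l' :: real
  assume u: "u \<in> limit_directions P" and v: "v \<in> limit_directions P"
    and l: "0 \<le> l" "0 \<le> l'" "l + l' = 1"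
  define w where "w = l *\<^sub>R u + l' *\<^sub>R v"
  have "\<exists>D S. P D S \<and> T \<le> S \<and> norm (D - S *\<^sub>R w) \<le> \<epsilon> * S" if \<epsilon>: "\<epsilon> > 0" for \<epsilon> T :: real
  proof -
    define M where "M = 2 + norm w + norm (u - v)"
    have M: "M > 0"
      unfolding M_def by (simp add: add_pos_nonneg)
    define \<delta> where "\<delta> = min (1/2) (\<epsilon> / (2 * M))"
    have \<delta>: "\<delta> > 0" "\<delta> \<le> 1/2" "\<delta> * M \<le> \<epsilon> / 2"
      using \<epsilon> M unfolding \<delta>_def by (auto simp: min_def field_simps)
    define T0 where "T0 = max 1 (max (2 * T) (K / \<delta>))"
    obtain d t where dt: "P d t" "T0 \<le> t" "norm (d - t *\<^sub>R u) \<le> \<delta> * t"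
      using u \<delta> unfolding limit_directions_iff by blast
    obtain d' t' where dt': "P d' t'" "T0 \<le> t'" "norm (d' - t' *\<^sub>R v) \<le> \<delta> * t'"
      using v \<delta> unfolding limit_directions_iff by blast
    have t: "t \<ge> 1" "t' \<ge> 1" "2 * T \<le> t" "K \<le> \<delta> * t" "K \<le> \<delta> * t'"
      using dt(2) dt'(2) \<delta> unfolding T0_def by (auto simp: field_simps)
    \<comment> \<open>The target length \<open>N\<close> is so large that rounding \<open>l * N / t\<close> and \<open>l' * N / t'\<close> to integers
      changes the share of each kind in the total length by at most \<open>\<delta>\<close>.\<close>
    define N where "N = (t + t') / \<delta>"
    have N: "N > 0" "t + t' = \<delta> * N"
      using t \<delta> unfolding N_def by auto
    define p where "p = nat \<lfloor>l * N / t\<rfloor>"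
    define q where "q = nat \<lfloor>l' * N / t'\<rfloor>"
    define a where "a = real (Suc p) * t"
    define b where "b = real (Suc q) * t'"
    have suc_floor: "x \<le> real (Suc (nat \<lfloor>x\<rfloor>))" "real (Suc (nat \<lfloor>x\<rfloor>)) \<le> x + 1" if "x \<ge> 0" for x :: real
      using that by linarith+
    have a: "l * N \<le> a" "a \<le> l * N + t"
      using suc_floor[of "l * N / t"] l N t unfolding a_def p_def by (simp_all add: field_simps)
    have b: "l' * N \<le> b" "b \<le> l' * N + t'"
      using suc_floor[of "l' * N / t'"] l N t unfolding b_def q_def by (simp_all add: field_simps)
    have "N = l * N + l' * N"
      using l by (simp flip: distrib_right)
    then have Nab: "N \<le> a + b"
      using a b by linarith
    have ta: "t \<le> a" "0 \<le> a" "0 \<le> b"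
      using t unfolding a_def b_def by (simp_all add: algebra_simps)
    have K1: "(real p + real q + 1) * K \<le> \<delta> * (a + b)"
    proof -
      have "real (Suc p) * K \<le> real (Suc p) * (\<delta> * t)" "real (Suc q) * K \<le> real (Suc q) * (\<delta> * t')"
        using t by (auto intro!: mult_left_mono simp del: of_nat_Suc)
      then have "(real (Suc p) + real (Suc q)) * K \<le> \<delta> * (a + b)"
        unfolding a_def b_def by (simp add: algebra_simps)
      then show ?thesis
        using K by (simp add: algebra_simps)
    qed
    obtain D S where DS: "P D S"
      "norm (D - (real (Suc p) *\<^sub>R d + real (Suc q) *\<^sub>R d')) \<le> \<delta> * (a + b)"
      "\<bar>S - (a + b)\<bar> \<le> \<delta> * (a + b)"
      using approximately_additive_multiples[OF add K dt(1) dt'(1), of p q, folded a_def b_def]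
        order_trans[OF _ K1] by blast
    have "\<delta> * (a + b) \<le> (1/2) * (a + b)"
      using \<delta> ta by (intro mult_right_mono) auto
    then have S: "(a + b) / 2 \<le> S"
      using DS(3) by simp
    have "\<bar>l' * a - l * b\<bar> \<le> \<delta> * (a + b)"
    proof -
      have eq: "l' * a - l * b = l' * (a - l * N) - l * (b - l' * N)"
        by (simp add: algebra_simps)
      have "0 \<le> l' * (a - l * N)" "0 \<le> l * (b - l' * N)"
        using a b l by simp_all
      moreover have "l' * (a - l * N) \<le> 1 * t" "l * (b - l' * N) \<le> 1 * t'"
        using a b l t by (intro mult_mono; simp)+
      ultimately have "\<bar>l' * a - l * b\<bar> \<le> t + t'"
        unfolding eq using t by linarith
      also have "\<dots> \<le> \<delta> * (a + b)"
        using N Nab \<delta> by simp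
      finally show ?thesis .
    qed
    then have mix: "norm ((l' * a - l * b) *\<^sub>R (u - v)) \<le> \<delta> * (a + b) * norm (u - v)"
      by (simp add: mult_right_mono)
    have eq: "D - S *\<^sub>R w = (D - (real (Suc p) *\<^sub>R d + real (Suc q) *\<^sub>R d'))
        + real (Suc p) *\<^sub>R (d - t *\<^sub>R u) + real (Suc q) *\<^sub>R (d' - t' *\<^sub>R v)
        + (l' * a - l * b) *\<^sub>R (u - v) - (S - (a + b)) *\<^sub>R w"
    proof -
      have "l' = 1 - l"
        using l by simp
      have "a *\<^sub>R u + b *\<^sub>R v = (l' * a - l * b) *\<^sub>R (u - v) + (a + b) *\<^sub>R w"
        unfolding w_def \<open>l' = 1 - l\<close> by (simp add: algebra_simps)
      then show ?thesis
        unfolding a_def b_def by (simp add: algebra_simps)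
    qed
    have "norm (D - S *\<^sub>R w) \<le> norm (D - (real (Suc p) *\<^sub>R d + real (Suc q) *\<^sub>R d'))
        + norm (real (Suc p) *\<^sub>R (d - t *\<^sub>R u)) + norm (real (Suc q) *\<^sub>R (d' - t' *\<^sub>R v))
        + norm ((l' * a - l * b) *\<^sub>R (u - v)) + norm ((S - (a + b)) *\<^sub>R w)"
      unfolding eq by (intro order_trans[OF norm_triangle_ineq4] add_mono order_trans[OF norm_triangle_ineq] order_refl)
    also have "\<dots> \<le> \<delta> * (a + b) + \<delta> * a + \<delta> * b + \<delta> * (a + b) * norm (u - v) + \<delta> * (a + b) * norm w"
    proof (intro add_mono)
      show "norm (real (Suc p) *\<^sub>R (d - t *\<^sub>R u)) \<le> \<delta> * a"
        using mult_left_mono[OF dt(3), of "real (Suc p)"] unfolding a_def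
        by (simp add: mult_ac del: of_nat_Suc)
      show "norm (real (Suc q) *\<^sub>R (d' - t' *\<^sub>R v)) \<le> \<delta> * b"
        using mult_left_mono[OF dt'(3), of "real (Suc q)"] unfolding b_def
        by (simp add: mult_ac del: of_nat_Suc)
      show "norm ((S - (a + b)) *\<^sub>R w) \<le> \<delta> * (a + b) * norm w"
        using DS(3) by (simp add: mult_right_mono)
    qed (use DS mix in auto)
    also have "\<dots> = \<delta> * M * (a + b)"
      unfolding M_def by (simp add: algebra_simps)
    also have "\<dots> \<le> \<epsilon> / 2 * (a + b)"
      using \<delta> ta by (intro mult_right_mono) auto
    also have "\<dots> \<le> \<epsilon> * S"
      using mult_left_mono[OF S, of \<epsilon>] \<epsilon> by simp
    finally show ?thesis
      using DS(1) S ta t by (intro exI[of _ D] exI[of _ S]) auto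
  qed
  then show "l *\<^sub>R u + l' *\<^sub>R v \<in> limit_directions P"
    unfolding limit_directions_iff w_def by blast
qed


section \<open>Concatenation of admissible pieces\<close>

lemma mem_obstacle_translate: "x \<in> obstacle B (k + q) \<longleftrightarrow> x - lattice_vec q \<in> obstacle B k"
  unfolding obstacle_translate by (auto intro: image_eqI[of _ _ "x - lattice_vec q"])

lemma trajectory_vertices:
  assumes "billiard_obstacle B" "trajectory_of_type B s k z"
  obtains q where "\<And>i. i \<le> s \<Longrightarrow> z i - lattice_vec q \<in> obstacle B (k i)"
proof -
  obtain q where "\<forall>i\<le>s. z i \<in> frontier (obstacle B (k i + q))"
    using assms(2) unfolding trajectory_of_type_def by blast
  then have "z i - lattice_vec q \<in> obstacle B (k i)" if "i \<le> s" for i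
    using that frontier_subset_compact[OF obstacle_geometry(1)[OF assms(1)]]
    unfolding mem_obstacle_translate[symmetric] by blast
  then show ?thesis
    using that by blast
qed

lemma trajectory_displacement:
  assumes "billiard_obstacle B" "small_obstacle B" "trajectory_of_type B s k z"
  shows "norm ((z s - z 0) - (lattice_vec (k s) - lattice_vec (k 0))) \<le> 1"
proof -
  obtain q where "\<And>i. i \<le> s \<Longrightarrow> z i - lattice_vec q \<in> obstacle B (k i)"
    using trajectory_vertices[OF assms(1,3)] by blast
  then show ?thesis
    using dist_obstacle_le[OF assms(2), of "z 0 - lattice_vec q" "k 0" "z s - lattice_vec q" "k s"] by simp
qed

lemma norm_unit_step:
  fixes c :: "int ^ 'm"
  assumes "unit_step c"
  shows "norm (lattice_vec c) = 1"
proof -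
  note assms
  moreover have "lattice_vec (axis p x) = axis p (of_int x)" for p :: 'm and x
    by (simp add: lattice_vec_def axis_def vec_eq_iff)
  ultimately show ?thesis
    unfolding unit_step_def by (auto simp: norm_eq_sqrt_inner inner_axis_axis)
qed

lemma path_length_append:
  "path_length (a + b) z = path_length a z + path_length b (\<lambda>j. z (a + j))"
  unfolding path_length_def by (induction b) (simp_all add: add.assoc)

lemma path_length_translate:
  fixes z :: "nat \<Rightarrow> 'a::real_normed_vector"
  shows "path_length s (\<lambda>i. z i + a) = path_length s z" "path_length s (\<lambda>i. z i - a) = path_length s z"
  unfolding path_length_def by (simp_all add: dist_norm)

lemma path_length_linked:
  "path_length (s + 2 + s') y = path_length s y + dist (y s) (y (s + 1))
    + dist (y (s + 1)) (y (s + 2)) + path_length s' (\<lambda>j. y (s + 2 + j))"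
proof -
  have "path_length (s + 2) y = path_length s y + dist (y s) (y (s + 1)) + dist (y (s + 1)) (y (s + 2))"
    unfolding path_length_def by (simp add: numeral_eq_Suc)
  then show ?thesis
    unfolding path_length_append[of "s + 2" s'] by simp
qed

lemma linked_displacement:
  fixes B :: "(real ^ 'm) set"
  assumes B: "billiard_obstacle B" and small: "small_obstacle B"
    and c: "unit_step c" "unit_step c'" and start: "k 0 = 0" "k' 0 = 0"
    and z: "trajectory_of_type B s k z" and z': "trajectory_of_type B s' k' z'"
    and Z: "trajectory_of_type B (s + 2 + s') (link s k c c' k') Z"
  shows "norm ((Z (s + 2 + s') - Z 0) - ((z s - z 0) + (z' s' - z' 0))) \<le> 5"
proof -
  define D where "D = Z (s + 2 + s') - Z 0"
  define f where "f = (z s - z 0) - lattice_vec (k s)"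
  define f' where "f' = (z' s' - z' 0) - lattice_vec (k' s')"
  define F where "F = D - lattice_vec (k' s' + (k s + c + c'))"
  have "link s k c c' k' 0 = 0"
    using link_simps(1)[of 0 s k c c' k'] start by simp
  then have "norm F \<le> 1"
    using trajectory_displacement[OF B small Z] unfolding F_def D_def link_simps(3) by simp
  moreover have "norm f \<le> 1" "norm f' \<le> 1"
    using trajectory_displacement[OF B small z] trajectory_displacement[OF B small z'] start
    unfolding f_def f'_def by simp_all
  moreover have eq: "D - ((z s - z 0) + (z' s' - z' 0)) = F + (lattice_vec c + lattice_vec c' - (f + f'))"
    unfolding F_def f_def f'_def by simp
  ultimately show ?thesis
    unfolding D_def[symmetric] eq
    using norm_triangle_ineq[of F "lattice_vec c + lattice_vec c' - (f + f')"]
      norm_triangle_ineq4[of "lattice_vec c + lattice_vec c'" "f + f'"]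
      norm_triangle_ineq[of "lattice_vec c" "lattice_vec c'"] norm_triangle_ineq[of f f']
      norm_unit_step[OF c(1)] norm_unit_step[OF c(2)]
    by linarith
qed

text \<open>The given pieces, joined through a point of the intermediate obstacle, form a path of the linked type.
It has two additional edges, each of length at most \<open>2\<close>, and \<open>Z\<close> exceeds its length by at most \<open>2\<close>.\<close>

lemma linked_path_length_le:
  fixes B :: "(real ^ 'm) set"
  assumes B: "billiard_obstacle B" and small: "small_obstacle B"
    and c: "unit_step c" "unit_step c'" and start: "k' 0 = 0"
    and z: "trajectory_of_type B s k z" and z': "trajectory_of_type B s' k' z'"
    and Z: "trajectory_of_type B (s + 2 + s') (link s k c c' k') Z"
  shows "path_length (s + 2 + s') Z \<le> path_length s z + path_length s' z' + 6"
proof -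
  define e where "e = k s + c + c'"
  define K where "K = link s k c c' k'"
  note K = link_simps[where s = s and k = k and c = c and c' = c' and k' = k', folded K_def e_def]
  obtain q where q: "\<And>i. i \<le> s \<Longrightarrow> z i - lattice_vec q \<in> obstacle B (k i)"
    using trajectory_vertices[OF B z] by blast
  obtain q' where q': "\<And>i. i \<le> s' \<Longrightarrow> z' i - lattice_vec q' \<in> obstacle B (k' i)"
    using trajectory_vertices[OF B z'] by blast
  obtain m where m: "m \<in> obstacle B (K (s + 1))"
    using obstacle_geometry(5)[OF B] by blast
  define Y where "Y i = (if i \<le> s then z i - lattice_vec q else if i = s + 1 then m
      else z' (i - (s + 2)) + (lattice_vec e - lattice_vec q'))" for i
  have Y: "Y i = z i - lattice_vec q" if "i \<le> s" for i
    using that unfolding Y_def by simp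
  have Y1: "Y (s + 1) = m" and Y2: "Y (s + 2 + j) = z' j + (lattice_vec e - lattice_vec q')" for j
    unfolding Y_def by simp_all
  have Y_in: "Y i \<in> obstacle B (K i)" if i: "i \<le> s + 2 + s'" for i
  proof -
    consider "i \<le> s" | "i = s + 1" | "s + 2 \<le> i"
      by linarith
    then show ?thesis
    proof cases
      case 3
      define j where "j = i - (s + 2)"
      have j: "i = s + 2 + j" "j \<le> s'"
        using 3 i unfolding j_def by simp_all
      have "z' j - lattice_vec q' \<in> obstacle B (k' j)"
        using q' j by blast
      then show ?thesis
        unfolding j(1) K(3) Y2 mem_obstacle_translate by (simp add: algebra_simps)
    qed (use Y Y1 K(1) q m in simp_all)
  qed
  have step: "dist (Y i) (Y (i + 1)) \<le> 2"
    if "i + 1 \<le> s + 2 + s'" "norm (lattice_vec (K (i + 1)) - lattice_vec (K i)) = 1" for i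
    using dist_obstacle_le[OF small Y_in Y_in, of i "i + 1"] that
      norm_triangle_ineq2[of "Y (i + 1) - Y i" "lattice_vec (K (i + 1)) - lattice_vec (K i)"]
    by (simp add: dist_norm norm_minus_commute)
  have "dist (Y s) (Y (s + 1)) \<le> 2"
    using step[of s] K(1)[of s] K(2) norm_unit_step[OF c(1)] by simp
  moreover have "dist (Y (s + 1)) (Y (s + 2)) \<le> 2"
    using step[of "s + 1"] K(2) K(3)[of 0] start norm_unit_step[OF c(2)] unfolding e_def by simp
  moreover have "path_length s Y = path_length s z"
    using path_length_cong[of s Y, OF Y] path_length_translate(2)[of s z "lattice_vec q"] by simp
  moreover have "path_length s' (\<lambda>j. Y (s + 2 + j)) = path_length s' z'"
    unfolding Y2 by (rule path_length_translate)
  ultimately show ?thesis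
    using trajectory_nearly_shortest[OF B small Z[folded K_def] Y_in] path_length_linked[of s s' Y]
    by linarith
qed

text \<open>The parts of \<open>Z\<close> that belong to \<open>k\<close> and to \<open>k'\<close> are paths of these types, so they are not shorter than
the given pieces by more than \<open>2\<close> each.\<close>

lemma linked_path_length_ge:
  fixes B :: "(real ^ 'm) set"
  assumes B: "billiard_obstacle B" and small: "small_obstacle B"
    and z: "trajectory_of_type B s k z" and z': "trajectory_of_type B s' k' z'"
    and Z: "trajectory_of_type B (s + 2 + s') (link s k c c' k') Z"
  shows "path_length s z + path_length s' z' - 4 \<le> path_length (s + 2 + s') Z"
proof -
  define e where "e = k s + c + c'"
  note K = link_simps[where s = s and k = k and c = c and c' = c' and k' = k', folded e_def]
  obtain Q where Q: "\<And>i. i \<le> s + 2 + s' \<Longrightarrow> Z i - lattice_vec Q \<in> obstacle B (link s k c c' k' i)"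
    using trajectory_vertices[OF B Z] by blast
  have "path_length s z \<le> path_length s (\<lambda>i. Z i - lattice_vec Q) + 2"
  proof (rule trajectory_nearly_shortest[OF B small z])
    show "Z i - lattice_vec Q \<in> obstacle B (k i)" if "i \<le> s" for i
      using Q[of i] K(1)[OF that] that by simp
  qed
  moreover have "path_length s' z' \<le> path_length s' (\<lambda>j. Z (s + 2 + j) - lattice_vec (e + Q)) + 2"
  proof (rule trajectory_nearly_shortest[OF B small z'])
    show "Z (s + 2 + j) - lattice_vec (e + Q) \<in> obstacle B (k' j)" if "j \<le> s'" for j
      using Q[of "s + 2 + j"] that K(3)[of j] mem_obstacle_translate[of _ B "k' j" e]
      by (simp add: algebra_simps)
  qed
  ultimately show ?thesis
    unfolding path_length_translate using path_length_linked[of s s' Z] zero_le_dist[of "Z s" "Z (s + 1)"]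
      zero_le_dist[of "Z (s + 1)" "Z (s + 2)"] by linarith
qed

lemma approximately_additive_pieces:
  fixes B :: "(real ^ 'm) set"
  assumes dim: "CARD('m) \<ge> 2" and B: "billiard_obstacle B" and small: "small_obstacle B"
  shows "approximately_additive 6 (\<lambda>d t. \<exists>x y. admissible_piece B x y t \<and> d = y - x)"
  unfolding approximately_additive_def
proof (intro allI impI)
  fix d d' :: "real ^ 'm" and t t' :: real
  assume "\<exists>x y. admissible_piece B x y t \<and> d = y - x" "\<exists>x y. admissible_piece B x y t' \<and> d' = y - x"
  then obtain s k z s' k' z' where
    k: "admissible B s k" and z: "trajectory_of_type B s k z" and d: "d = z s - z 0" "t = path_length s z" and
    k': "admissible B s' k'" and z': "trajectory_of_type B s' k' z'" and d': "d' = z' s' - z' 0" "t' = path_length s' z'"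
    unfolding admissible_piece_def path_length_def by blast
  have start: "k 0 = 0" "k' 0 = 0"
    using k k' unfolding admissible_def by auto
  obtain c c' where c: "unit_step c" "unit_step c'" and
    turns: "lattice_vec (k s - k (s - 1)) \<bullet> lattice_vec c \<le> 0" "lattice_vec c \<bullet> lattice_vec c' \<le> 0"
      "lattice_vec c' \<bullet> lattice_vec (k' 1) \<le> 0"
    using exists_linking_steps[OF dim] by blast
  have K: "admissible B (s + 2 + s') (link s k c c' k')"
    by (rule admissible_link[OF small k k' c turns])
  then obtain Z where Z: "trajectory_of_type B (s + 2 + s') (link s k c c' k') Z"
    using admissible_type_realised[OF B K] by auto
  let ?D = "Z (s + 2 + s') - Z 0" and ?T = "path_length (s + 2 + s') Z"
  have "norm (?D - (d + d')) \<le> 6"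
    using linked_displacement[OF B small c start z z' Z] unfolding d d' by simp
  moreover have "\<bar>?T - (t + t')\<bar> \<le> 6"
    using linked_path_length_le[OF B small c start(2) z z' Z] linked_path_length_ge[OF B small z z' Z]
    unfolding d d' by linarith
  moreover have "admissible_piece B (Z 0) (Z (s + 2 + s')) ?T"
    unfolding admissible_piece_def path_length_def using K Z by blast
  ultimately show "\<exists>D T. (\<exists>x y. admissible_piece B x y T \<and> D = y - x) \<and>
      norm (D - (d + d')) \<le> 6 \<and> \<bar>T - (t + t')\<bar> \<le> 6"
    by blast
qed

lemma admissible_rotation_set_eq:
  "admissible_rotation_set B = limit_directions (\<lambda>d t. \<exists>x y. admissible_piece B x y t \<and> d = y - x)"
proof (intro set_eqI iffI)
  fix w
  assume "w \<in> admissible_rotation_set B"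
  then obtain x y t where "\<forall>n. admissible_piece B (x n) (y n) (t n)"
    "filterlim t at_top sequentially" "(\<lambda>n. (y n - x n) /\<^sub>R t n) \<longlonglongrightarrow> w"
    unfolding admissible_rotation_set_def by blast
  then show "w \<in> limit_directions (\<lambda>d t. \<exists>x y. admissible_piece B x y t \<and> d = y - x)"
    unfolding limit_directions_def by (intro CollectI exI[of _ "\<lambda>n. y n - x n"] exI[of _ t]) blast
next
  fix w
  assume "w \<in> limit_directions (\<lambda>d t. \<exists>x y. admissible_piece B x y t \<and> d = y - x)"
  then obtain d t where P: "\<forall>n. \<exists>x y. admissible_piece B x y (t n) \<and> d n = y - x"
    and t: "filterlim t at_top sequentially" and lim: "(\<lambda>n. d n /\<^sub>R t n) \<longlonglongrightarrow> w"
    unfolding limit_directions_def by blast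
  obtain x y where "\<forall>n. admissible_piece B (x n) (y n) (t n) \<and> d n = y n - x n"
    using P by metis
  then show "w \<in> admissible_rotation_set B"
    unfolding admissible_rotation_set_def using t lim
    by (intro CollectI exI[of _ x] exI[of _ y] exI[of _ t]) simp
qed

theorem theorem3p1:
  fixes B :: "(real ^ 'm) set"
  assumes "CARD('m) \<ge> 2"
    and "billiard_obstacle B"
    and "small_obstacle B"
  shows "convex (admissible_rotation_set B)"
  unfolding admissible_rotation_set_eq
  using convex_limit_directions[OF approximately_additive_pieces[OF assms]] by simp

end
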